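(* Let $\mathbf{X}_\tau=(X_{\tau,1},\ldots,X_{\tau,k})'$, $\tau=0,\ldots,T$, be a sequence of independently distributed random return vectors of $k$ risky assets, let $r_{f,\tau}$ be the return of the riskless asset, and let $E(\mathbf{X}_\tau)=\boldsymbol{\mu}_\tau$ and $\mathrm{Var}(\mathbf{X}_\tau)=\boldsymbol{\Sigma}_\tau$, where $\boldsymbol{\Sigma}_\tau$ is positive definite. Consider the multi-period portfolio choice problem with riskless asset $$\max_{\{\mathbf{w}_s\}_{s=0}^{T-1}}E_0\Big[W_T-\frac{\alpha}{2}W_T^2\Big],\qquad W_t=W_{t-1}\big(R_{f,t}+\mathbf{w}_{t-1}'(\mathbf{X}_t-r_{f,t}\mathbf{1})\big).$$ Then for all $t=1,\ldots,T$ the optimal multi-period portfolio weights for period $T-t$ are given by $$\mathbf{w}^*_{T-t}=\alpha_{T-t+1}^{-1}\boldsymbol{\Sigma}^{-1}_{T-t+1}\breve{\boldsymbol{\mu}}_{T-t+1},$$ where $$\alpha_{T-t+1}^{-1}=\frac{\frac{1}{\alpha W_{T-t}}\Big(\prod_{i=T-t+2}^{T}R_{f,i}\Big)^{-1}-R_{f,T-t+1}}{1+\breve{\boldsymbol{\mu}}_{T-t+1}'\boldsymbol{\Sigma}^{-1}_{T-t+1}\breve{\boldsymbol{\mu}}_{T-t+1}}.$$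
   Context: $(\mathcal{F}_\tau)$ is the filtration of information available to the investor, $E_t(\cdot)=E(\cdot\mid\mathcal{F}_t)$; independence means that $\mathbf{X}_\tau$ is independent of $\mathcal{F}_{\tau-1}$, so conditional and unconditional moments coincide. $\mathbf{1}$ is the $k$-vector of ones, $'$ denotes transpose, and empty products equal $1$. The riskless returns $r_{f,t}$ are deterministic, $R_{f,t}=1+r_{f,t}\neq0$, and $\breve{\boldsymbol{\mu}}_t=\boldsymbol{\mu}_t-r_{f,t}\mathbf{1}$. The symbol $\alpha_{T-t+1}^{-1}$ simply denotes the displayed real number (possibly zero). The investor has initial wealth $W_0$ and invests over $T$ periods. At each time $s=0,\ldots,T-1$ a vector $\mathbf{w}_s\in\mathbb{R}^k$ of weights of the $k$ risky assets is chosen without constraint, depending only on $\mathcal{F}_s$; the remaining fraction $1-\mathbf{w}_s'\mathbf{1}$ is put into the riskless asset. The utility function is $U(W)=W-\frac{\alpha}{2}W^2$ with $\alpha>0$. Optimality is in the sense of dynamic programming: the value function is $V(t,W_t,\mathcal{F}_t)=\max_{\{\mathbf{w}_s\}_{s=t}^{T-1}}E_t[U(W_T)]$, with $V(T,W_T,\mathcal{F}_T)=U(W_T)$, and satisfies $V(T-t,W_{T-t},\mathcal{F}_{T-t})=\max_{\mathbf{w}_{T-t}}E_{T-t}[V(T-t+1,W_{T-t}(R_{f,T-t+1}+\mathbf{w}_{T-t}'(\mathbf{X}_{T-t+1}-r_{f,T-t+1}\mathbf{1})),\mathcal{F}_{T-t+1})]$. The weights $\mathbf{w}^*_{T-t}$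 are the maximizer at time $T-t$, as a function of the current wealth $W_{T-t}$, assumed nonzero.
   Formalization: That the stated weights are optimal at time T-t is proved, for t>1, when the resulting next wealth W_{T-t+1} is also almost surely nonzero; otherwise a maximizer may fail to exist. That any optimal weights equal the formula needs only W_{T-t} nonzero. *)

theory Defs
  imports "HOL-Probability.Probability"
begin

section \<open>Moments of random vectors\<close>

definition covariance_matrix :: "'a measure \<Rightarrow> ('a \<Rightarrow> real ^ 'k) \<Rightarrow> real ^ 'k ^ 'k" where
  "covariance_matrix M Y =
     (\<chi> i j. \<integral>\<omega>. (Y \<omega> $ i - (\<integral>\<omega>. Y \<omega> $ i \<partial>M)) * (Y \<omega> $ j - (\<integral>\<omega>. Y \<omega> $ j \<partial>M)) \<partial>M)"

definition positive_definite :: "real ^ 'k ^ 'k \<Rightarrow> bool" where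
  "positive_definite A \<longleftrightarrow> transpose A = A \<and> (\<forall>x. x \<noteq> 0 \<longrightarrow> 0 < x \<bullet> (A *v x))"


section \<open>Conditional expectation and essential supremum\<close>

text \<open>
  Portfolio weights carry no integrability restriction, so terminal utility need not be integrable;
  it is, however, bounded above. The library's \<^const>\<open>real_cond_exp\<close> replaces an infinite
  conditional expectation of the negative part by zero. The following version takes the difference
  of the two conditional expectations in the extended reals instead, and so has the value
  \<open>-\<infinity>\<close> there.
\<close>

definition ereal_cond_exp :: "'a measure \<Rightarrow> 'a measure \<Rightarrow> ('a \<Rightarrow> ereal) \<Rightarrow> 'a \<Rightarrow> ereal" where
  "ereal_cond_exp M G f \<omega> =
     enn2ereal (nn_cond_exp M G (\<lambda>x. e2ennreal (f x)) \<omega>)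
     - enn2ereal (nn_cond_exp M G (\<lambda>x. e2ennreal (- f x)) \<omega>)"

text \<open>
  Conditional expectations are determined only almost surely, so the maximum of an uncountable
  family of them cannot be taken pointwise. It is read as the almost surely least
  \<open>G\<close>-measurable upper bound; a member of the family that dominates all others almost surely
  is such a bound.
\<close>

definition is_ess_sup ::
  "'a measure \<Rightarrow> 'a measure \<Rightarrow> ('a \<Rightarrow> ereal) set \<Rightarrow> ('a \<Rightarrow> ereal) \<Rightarrow> bool" where
  "is_ess_sup M G A v \<longleftrightarrow>
     v \<in> borel_measurable G \<and>
     (\<forall>f\<in>A. AE \<omega> in M. f \<omega> \<le> v \<omega>) \<and>
     (\<forall>u\<in>borel_measurable G. (\<forall>f\<in>A. AE \<omega> in M. f \<omega> \<le> u \<omega>) \<longrightarrow> (AE \<omega> in M. v \<omega> \<le> u \<omega>))"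

definition ess_sup :: "'a measure \<Rightarrow> 'a measure \<Rightarrow> ('a \<Rightarrow> ereal) set \<Rightarrow> 'a \<Rightarrow> ereal" where
  "ess_sup M G A = (SOME v. is_ess_sup M G A v)"


section \<open>The portfolio problem\<close>

definition quadratic_utility :: "real \<Rightarrow> real \<Rightarrow> real" where
  "quadratic_utility \<alpha> x = x - \<alpha> / 2 * x\<^sup>2"

text \<open>
  Gross portfolio return of period \<open>\<tau>\<close> for the weights \<open>v\<close> chosen at time \<open>\<tau> - 1\<close>.
\<close>

definition gross_return ::
  "(nat \<Rightarrow> real) \<Rightarrow> (nat \<Rightarrow> 'a \<Rightarrow> real ^ 'k) \<Rightarrow> nat \<Rightarrow> ('a \<Rightarrow> real ^ 'k) \<Rightarrow> 'a \<Rightarrow> real" where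
  "gross_return r X \<tau> v \<omega> = (1 + r \<tau>) + v \<omega> \<bullet> (X \<tau> \<omega> - r \<tau> *\<^sub>R 1)"

text \<open>
  Wealth at time \<open>n + j\<close> of an investor who holds \<open>Y\<close> at time \<open>n\<close> and uses the weights
  \<open>w n, w (n + 1), \<dots>\<close>
\<close>

primrec wealth ::
  "(nat \<Rightarrow> real) \<Rightarrow> (nat \<Rightarrow> 'a \<Rightarrow> real ^ 'k) \<Rightarrow> nat \<Rightarrow> ('a \<Rightarrow> real) \<Rightarrow>
   (nat \<Rightarrow> 'a \<Rightarrow> real ^ 'k) \<Rightarrow> nat \<Rightarrow> 'a \<Rightarrow> real" where
  "wealth r X n Y w 0 = Y"
| "wealth r X n Y w (Suc j) =
     (\<lambda>\<omega>. wealth r X n Y w j \<omega> * gross_return r X (Suc (n + j)) (w (n + j)) \<omega>)"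

definition strategies :: "(nat \<Rightarrow> 'a measure) \<Rightarrow> nat \<Rightarrow> nat \<Rightarrow> (nat \<Rightarrow> 'a \<Rightarrow> real ^ 'k) set" where
  "strategies F n T = {w. \<forall>s\<in>{n..<T}. w s \<in> borel_measurable (F s)}"

text \<open>
  The value function \<open>V(n, Y, F n)\<close>. The wealth \<open>Y\<close> held at time \<open>n\<close> is an
  \<open>F n\<close>-measurable random variable.
\<close>

definition value_function ::
  "'a measure \<Rightarrow> (nat \<Rightarrow> 'a measure) \<Rightarrow> (nat \<Rightarrow> real) \<Rightarrow> (nat \<Rightarrow> 'a \<Rightarrow> real ^ 'k) \<Rightarrow>
   real \<Rightarrow> nat \<Rightarrow> nat \<Rightarrow> ('a \<Rightarrow> real) \<Rightarrow> 'a \<Rightarrow> ereal" where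
  "value_function M F r X \<alpha> T n Y =
     ess_sup M (F n)
       ((\<lambda>w. ereal_cond_exp M (F n)
               (\<lambda>\<omega>. ereal (quadratic_utility \<alpha> (wealth r X n Y w (T - n) \<omega>))))
        ` strategies F n T)"

text \<open>
  Objective and maximizers on the right-hand side of the Bellman equation at time \<open>n\<close> with
  current wealth \<open>Y\<close>.
\<close>

definition bellman_objective ::
  "'a measure \<Rightarrow> (nat \<Rightarrow> 'a measure) \<Rightarrow> (nat \<Rightarrow> real) \<Rightarrow> (nat \<Rightarrow> 'a \<Rightarrow> real ^ 'k) \<Rightarrow>
   real \<Rightarrow> nat \<Rightarrow> nat \<Rightarrow> ('a \<Rightarrow> real) \<Rightarrow> ('a \<Rightarrow> real ^ 'k) \<Rightarrow> 'a \<Rightarrow> ereal" where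
  "bellman_objective M F r X \<alpha> T n Y v =
     ereal_cond_exp M (F n)
       (value_function M F r X \<alpha> T (Suc n) (\<lambda>\<omega>. Y \<omega> * gross_return r X (Suc n) v \<omega>))"

definition bellman_maximizer ::
  "'a measure \<Rightarrow> (nat \<Rightarrow> 'a measure) \<Rightarrow> (nat \<Rightarrow> real) \<Rightarrow> (nat \<Rightarrow> 'a \<Rightarrow> real ^ 'k) \<Rightarrow>
   real \<Rightarrow> nat \<Rightarrow> nat \<Rightarrow> ('a \<Rightarrow> real) \<Rightarrow> ('a \<Rightarrow> real ^ 'k) \<Rightarrow> bool" where
  "bellman_maximizer M F r X \<alpha> T n Y v \<longleftrightarrow>
     v \<in> borel_measurable (F n) \<and>
     (\<forall>u\<in>borel_measurable (F n).
        AE \<omega> in M. bellman_objective M F r X \<alpha> T n Y u \<omega> \<le> bellman_objective M F r X \<alpha> T n Y v \<omega>)"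

section \<open>The closed-form weights\<close>

definition excess_mean :: "(nat \<Rightarrow> real) \<Rightarrow> (nat \<Rightarrow> real ^ 'k) \<Rightarrow> nat \<Rightarrow> real ^ 'k" where
  "excess_mean r \<mu> \<tau> = \<mu> \<tau> - r \<tau> *\<^sub>R 1"

text \<open>
  The scalar written \<open>\<alpha>\<^sub>\<tau>\<close> to the power \<open>-1\<close>, for current wealth \<open>x\<close> at time \<open>\<tau> - 1\<close>. It may
  vanish, so it is not the inverse of some number \<open>\<alpha>\<^sub>\<tau>\<close>.
\<close>

definition alpha_inv ::
  "real \<Rightarrow> (nat \<Rightarrow> real) \<Rightarrow> (nat \<Rightarrow> real ^ 'k) \<Rightarrow> (nat \<Rightarrow> real ^ 'k ^ 'k) \<Rightarrow>
   nat \<Rightarrow> nat \<Rightarrow> real \<Rightarrow> real" where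
  "alpha_inv \<alpha> r \<mu> \<Sigma> T \<tau> x =
     (1 / (\<alpha> * x) * inverse (\<Prod>i=\<tau>+1..T. 1 + r i) - (1 + r \<tau>))
     / (1 + excess_mean r \<mu> \<tau> \<bullet> (matrix_inv (\<Sigma> \<tau>) *v excess_mean r \<mu> \<tau>))"

end

theory Submission
  imports Defs
begin

text \<open>
  Completing the square turns the utility into \<open>1/(2\<alpha>)\<close> minus a quadratic loss
  \<open>c\<^sub>T (W\<^sub>T - b\<^sub>T)\<^sup>2\<close>. By independence, one step of conditional expectation freezes the current
  wealth \<open>y\<close> and the weights \<open>u\<close>, and minimising over the amounts \<open>y u\<close> reproduces a loss
  \<open>c\<^sub>n (y - b\<^sub>n)\<^sup>2\<close> of the same shape with a unique minimiser. Zero wealth is absorbing and has the loss \<open>1/(2\<alpha>)\<close>,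
  which is at least the limit of these losses at 0, so the value function may be discontinuous there and the supremum need not be
  attained when the minimiser leads to zero wealth. It is approached by multiplying the minimiser by
  factors \<open>k > 1\<close> close to 1: all but countably many of them avoid zero wealth almost surely,
  at the price of a factor \<open>1 + \<delta>\<close> in the loss. Hence the value function is \<open>1/(2\<alpha>)\<close>
  minus this discontinuous loss, and any Bellman maximiser also minimises the quadratic loss.
\<close>

section \<open>Conditional expectations and essential suprema\<close>

text \<open>Independence makes the joint law of the \<open>G\<close>-information and
  \<open>X\<close> a product measure. By Tonelli, integrating \<open>f\<close> over a
  \<open>G\<close>-set then amounts to first integrating out \<open>X\<close> with the
  \<open>G\<close>-measurable argument held fixed.\<close>

lemma (in prob_space) nn_cond_exp_freeze:
  assumes subalg: "subalgebra M G"
    and X[measurable]: "X \<in> measurable M N"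
    and indep: "indep_set (sets G) (sets (vimage_algebra (space M) X N))"
    and f[measurable]: "(\<lambda>(\<omega>, x). f \<omega> x) \<in> borel_measurable (G \<Otimes>\<^sub>M N)"
  shows "AE \<omega> in M. nn_cond_exp M G (\<lambda>\<omega>. f \<omega> (X \<omega>)) \<omega> = (\<integral>\<^sup>+x. f \<omega> (X x) \<partial>M)"
proof -
  interpret finite_measure_subalgebra M G by unfold_locales (rule subalg)
  \<comment> \<open>The identity, read as a random element of \<open>G\<close>, carries exactly the
    information in \<open>G\<close>; its joint law with \<open>X\<close> lives on the product of
    \<open>G\<close> and \<open>N\<close>.\<close>
  have id[measurable]: "(\<lambda>\<omega>. \<omega>) \<in> measurable M G"
    by (rule measurable_from_subalg[OF subalg]) simp
  have sp: "space G = space M" using subalg by (simp add: subalgebra_def)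
  interpret N: prob_space "distr M N X" by (rule prob_space_distr) simp
  interpret G: prob_space "distr M G (\<lambda>\<omega>. \<omega>)" by (rule prob_space_distr) simp
  have prod: "distr M G (\<lambda>\<omega>. \<omega>) \<Otimes>\<^sub>M distr M N X = distr M (G \<Otimes>\<^sub>M N) (\<lambda>\<omega>. (\<omega>, X \<omega>))"
  proof (rule pair_measure_eqI)
    fix A B assume "A \<in> sets (distr M G (\<lambda>\<omega>. \<omega>))" "B \<in> sets (distr M N X)"
    then have [measurable]: "A \<in> sets G" "B \<in> sets N" by auto
    have A: "A \<inter> space M = A"
      using sets.sets_into_space[of A G] sp by auto
    have "X -` B \<inter> space M \<in> sets (vimage_algebra (space M) X N)"
      by (rule in_vimage_algebra) simp
    then have "prob (A \<inter> (X -` B \<inter> space M)) = prob A * prob (X -` B \<inter> space M)"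
      using indep_setD[OF indep] by simp
    moreover have "(\<lambda>\<omega>. (\<omega>, X \<omega>)) -` (A \<times> B) \<inter> space M = A \<inter> (X -` B \<inter> space M)"
      using A by auto
    ultimately show "emeasure (distr M G (\<lambda>\<omega>. \<omega>)) A * emeasure (distr M N X) B
        = emeasure (distr M (G \<Otimes>\<^sub>M N) (\<lambda>\<omega>. (\<omega>, X \<omega>))) (A \<times> B)"
      by (simp add: emeasure_distr A emeasure_eq_measure ennreal_mult)
  qed (auto intro: G.sigma_finite_measure_axioms N.sigma_finite_measure_axioms)
  have G_meas[measurable]: "(\<lambda>\<omega>. \<integral>\<^sup>+x. f \<omega> x \<partial>distr M N X) \<in> borel_measurable G"
    by (rule N.borel_measurable_nn_integral) simp
  have "AE \<omega> in M. (\<integral>\<^sup>+x. f \<omega> x \<partial>distr M N X) = nn_cond_exp M G (\<lambda>\<omega>. f \<omega> (X \<omega>)) \<omega>"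
  proof (rule nn_cond_exp_charact)
    fix A assume A[measurable]: "A \<in> sets G"
    have "(\<integral>\<^sup>+\<omega>\<in>A. (\<integral>\<^sup>+x. f \<omega> x \<partial>distr M N X) \<partial>M)
        = (\<integral>\<^sup>+\<omega>. (\<integral>\<^sup>+x. f \<omega> x * indicator A \<omega> \<partial>distr M N X) \<partial>distr M G (\<lambda>\<omega>. \<omega>))"
      by (subst nn_integral_distr) (auto simp: nn_integral_multc intro!: nn_integral_cong)
    also have "\<dots> = (\<integral>\<^sup>+(\<omega>, x). f \<omega> x * indicator A \<omega> \<partial>(distr M G (\<lambda>\<omega>. \<omega>) \<Otimes>\<^sub>M distr M N X))"
      by (subst N.nn_integral_fst[symmetric]) (auto simp: case_prod_beta)
    also have "\<dots> = (\<integral>\<^sup>+\<omega>\<in>A. f \<omega> (X \<omega>) \<partial>M)"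
      unfolding prod by (subst nn_integral_distr) auto
    finally show "(\<integral>\<^sup>+\<omega>\<in>A. f \<omega> (X \<omega>) \<partial>M) = (\<integral>\<^sup>+\<omega>\<in>A. (\<integral>\<^sup>+x. f \<omega> x \<partial>distr M N X) \<partial>M)" ..
  qed auto
  moreover have "(\<integral>\<^sup>+x. f \<omega> x \<partial>distr M N X) = (\<integral>\<^sup>+x. f \<omega> (X x) \<partial>M)" if "\<omega> \<in> space M" for \<omega>
    using that sp by (intro nn_integral_distr) auto
  ultimately show ?thesis by (auto elim: AE_mp)
qed

lemma (in sigma_finite_subalgebra) ereal_cond_exp_cong:
  assumes "AE \<omega> in M. f \<omega> = g \<omega>"
    and [measurable]: "f \<in> borel_measurable M" "g \<in> borel_measurable M"
  shows "AE \<omega> in M. ereal_cond_exp M F f \<omega> = ereal_cond_exp M F g \<omega>"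
proof -
  have "AE \<omega> in M. nn_cond_exp M F (\<lambda>x. e2ennreal (f x)) \<omega> = nn_cond_exp M F (\<lambda>x. e2ennreal (g x)) \<omega>"
    by (rule nn_cond_exp_cong) (use assms in auto)
  moreover have "AE \<omega> in M. nn_cond_exp M F (\<lambda>x. e2ennreal (- f x)) \<omega> = nn_cond_exp M F (\<lambda>x. e2ennreal (- g x)) \<omega>"
    by (rule nn_cond_exp_cong) (use assms in auto)
  ultimately show ?thesis by eventually_elim (simp add: ereal_cond_exp_def)
qed

text \<open>The bound on \<open>p\<close> keeps it finite, so no difference of two infinities can
  occur. Infinite \<open>l\<close> forces infinite \<open>n\<close>, and both sides are then minus
  infinity.\<close>

lemma enn2ereal_diff_balance:
  assumes "p + l = ennreal K + n" "p \<le> ennreal K" "0 \<le> K"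
  shows "enn2ereal p - enn2ereal n = ereal K - enn2ereal l"
  using assms by (cases p; cases l; cases n)
    (auto simp: top_unique ennreal_plus[symmetric] simp del: ennreal_plus)

text \<open>Positive and negative part of \<open>K - l\<close> satisfy \<open>p + l = K + n\<close>
  with \<open>p \<le> K\<close>. Additivity of the nonnegative conditional expectation preserves
  this balance, so \<open>l\<close> may have infinite conditional expectation.\<close>

lemma (in sigma_finite_subalgebra) ereal_cond_exp_const_diff:
  fixes l :: "'a \<Rightarrow> real"
  assumes K: "0 \<le> K" and l: "\<And>\<omega>. 0 \<le> l \<omega>" and [measurable]: "l \<in> borel_measurable M"
  shows "AE \<omega> in M. ereal_cond_exp M F (\<lambda>\<omega>. ereal (K - l \<omega>)) \<omega>
           = ereal K - enn2ereal (nn_cond_exp M F (\<lambda>\<omega>. ennreal (l \<omega>)) \<omega>)"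
proof -
  let ?p = "\<lambda>\<omega>. ennreal (K - l \<omega>)" and ?n = "\<lambda>\<omega>. ennreal (l \<omega> - K)"
  have split: "?p \<omega> + ennreal (l \<omega>) = ennreal K + ?n \<omega>" for \<omega>
  proof (cases "l \<omega> \<le> K")
    case True
    then show ?thesis using K l[of \<omega>] by (simp add: ennreal_neg flip: ennreal_plus)
  next
    case False
    then show ?thesis using K l[of \<omega>] by (simp add: ennreal_neg flip: ennreal_plus)
  qed
  have "AE \<omega> in M. nn_cond_exp M F ?p \<omega> + nn_cond_exp M F (\<lambda>\<omega>. ennreal (l \<omega>)) \<omega>
      = nn_cond_exp M F (\<lambda>\<omega>. ?p \<omega> + ennreal (l \<omega>)) \<omega>"
    by (rule nn_cond_exp_sum) auto
  moreover have "AE \<omega> in M. nn_cond_exp M F (\<lambda>_. ennreal K) \<omega> + nn_cond_exp M F ?n \<omega>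
      = nn_cond_exp M F (\<lambda>\<omega>. ennreal K + ?n \<omega>) \<omega>"
    by (rule nn_cond_exp_sum) auto
  moreover have "AE \<omega> in M. ennreal K = nn_cond_exp M F (\<lambda>_. ennreal K) \<omega>"
    by (rule nn_cond_exp_F_meas) auto
  moreover have "AE \<omega> in M. nn_cond_exp M F ?p \<omega> \<le> nn_cond_exp M F (\<lambda>_. ennreal K) \<omega>"
    by (rule nn_cond_exp_mono) (use l in \<open>auto intro!: ennreal_leI\<close>)
  ultimately show ?thesis
  proof eventually_elim
    case (elim \<omega>)
    then show ?case unfolding ereal_cond_exp_def split
      using enn2ereal_diff_balance[OF _ _ K, of "nn_cond_exp M F ?p \<omega>" _ "nn_cond_exp M F ?n \<omega>"]
      by simp
  qed
qed

lemma is_ess_sup_unique: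
  assumes "is_ess_sup M G A u" "is_ess_sup M G A v"
  shows "AE \<omega> in M. u \<omega> = v \<omega>"
proof -
  have "AE \<omega> in M. u \<omega> \<le> v \<omega>" "AE \<omega> in M. v \<omega> \<le> u \<omega>"
    using assms by (auto simp: is_ess_sup_def)
  then show ?thesis by eventually_elim simp
qed

text \<open>\<open>ess_sup\<close> picks an arbitrary version. One explicit essential supremum shows
  that the choice is a genuine one, determined almost surely and measurable.\<close>

lemma ess_sup_eq_AE:
  assumes "is_ess_sup M G A v"
  shows "AE \<omega> in M. ess_sup M G A \<omega> = v \<omega>" "ess_sup M G A \<in> borel_measurable G"
proof -
  have *: "is_ess_sup M G A (ess_sup M G A)"
    unfolding ess_sup_def using assms someI[of "is_ess_sup M G A"] by simp
  from is_ess_sup_unique[OF * assms] show "AE \<omega> in M. ess_sup M G A \<omega> = v \<omega>" .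
  from * show "ess_sup M G A \<in> borel_measurable G" by (simp add: is_ess_sup_def)
qed

section \<open>Auxiliary facts on positive definite matrices, the wealth recursion and
  limits\<close>

lemma positive_definite_matrix_inv:
  fixes A :: "real ^ 'k ^ 'k"
  assumes "positive_definite A"
  shows "A *v (matrix_inv A *v x) = x"
proof -
  have "y = 0" if "A *v y = 0" for y
    using assms that unfolding positive_definite_def by (metis inner_zero_right less_irrefl)
  then have "invertible A"
    by (simp add: invertible_left_inverse matrix_left_invertible_ker)
  then have "A ** matrix_inv A = mat 1"
    unfolding invertible_def matrix_inv_def by (rule someI2_ex) simp
  then show ?thesis by (simp add: matrix_vector_mul_assoc)
qed

lemma positive_definite_sym:
  fixes A :: "real ^ 'k ^ 'k"
  assumes "positive_definite A"
  shows "(A *v x) \<bullet> y = x \<bullet> (A *v y)"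
  using assms unfolding positive_definite_def
  by (metis dot_lmul_matrix transpose_matrix_vector)

text \<open>The recursion for \<open>wealth\<close> peels off the last period; backward induction
  has to peel off the first.\<close>

lemma wealth_Suc_shift:
  "wealth r X n Y w (Suc j)
    = wealth r X (Suc n) (\<lambda>\<omega>. Y \<omega> * gross_return r X (Suc n) (w n) \<omega>) w j"
  by (induction j) auto

lemma wealth_cong:
  "(\<And>i. n \<le> i \<Longrightarrow> w i = w' i) \<Longrightarrow> wealth r X n Y w j = wealth r X n Y w' j"
  by (induction j) auto

text \<open>Comparing utilities becomes comparing losses in reverse order, infinite losses
  included.\<close>

lemma ereal_const_diff_le_iff:
  "ereal K - enn2ereal x \<le> ereal K - enn2ereal y \<longleftrightarrow> y \<le> x"
  by (cases x; cases y) (auto simp: top_unique)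

lemma LIMSEQ_relative_slack: "(\<lambda>k. (1 + inverse (real (Suc k))) * x) \<longlonglongrightarrow> x"
  using tendsto_mult_right[OF tendsto_add[OF tendsto_const LIMSEQ_inverse_real_of_nat], of 1 x] by simp

section \<open>The quadratic loss\<close>

text \<open>The direction common to all closed-form weights of the period.\<close>

definition hedge :: "(nat \<Rightarrow> real) \<Rightarrow> (nat \<Rightarrow> real ^ 'k) \<Rightarrow> (nat \<Rightarrow> real ^ 'k ^ 'k) \<Rightarrow> nat \<Rightarrow> real ^ 'k" where
  "hedge r \<mu> \<Sigma> \<tau> = matrix_inv (\<Sigma> \<tau>) *v excess_mean r \<mu> \<tau>"

text \<open>The squared maximal Sharpe ratio of the period.\<close>

definition sharpe2 :: "(nat \<Rightarrow> real) \<Rightarrow> (nat \<Rightarrow> real ^ 'k) \<Rightarrow> (nat \<Rightarrow> real ^ 'k ^ 'k) \<Rightarrow> nat \<Rightarrow> real" where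
  "sharpe2 r \<mu> \<Sigma> \<tau> = excess_mean r \<mu> \<tau> \<bullet> hedge r \<mu> \<Sigma> \<tau>"

text \<open>The quadratic form of the uncentred second moment matrix of the excess returns.\<close>

definition second_moment ::
  "(nat \<Rightarrow> real) \<Rightarrow> (nat \<Rightarrow> real ^ 'k) \<Rightarrow> (nat \<Rightarrow> real ^ 'k ^ 'k) \<Rightarrow> nat \<Rightarrow> real ^ 'k \<Rightarrow> real" where
  "second_moment r \<mu> \<Sigma> \<tau> u = u \<bullet> (\<Sigma> \<tau> *v u) + (u \<bullet> excess_mean r \<mu> \<tau>)\<^sup>2"

text \<open>The satiation point 1/\<alpha> of the utility, discounted to time \<open>n\<close>:
  riskless investment of this wealth reaches 1/\<alpha> at time \<open>T\<close>.\<close>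

definition bliss :: "(nat \<Rightarrow> real) \<Rightarrow> real \<Rightarrow> nat \<Rightarrow> nat \<Rightarrow> real" where
  "bliss r \<alpha> T n = 1 / \<alpha> * inverse (\<Prod>i=n+1..T. 1 + r i)"

definition loss_coeff ::
  "(nat \<Rightarrow> real) \<Rightarrow> (nat \<Rightarrow> real ^ 'k) \<Rightarrow> (nat \<Rightarrow> real ^ 'k ^ 'k) \<Rightarrow> real \<Rightarrow> nat \<Rightarrow> nat \<Rightarrow> real" where
  "loss_coeff r \<mu> \<Sigma> \<alpha> T n = \<alpha> / 2 * (\<Prod>i=n+1..T. (1 + r i)\<^sup>2 / (1 + sharpe2 r \<mu> \<Sigma> i))"

lemma measurable_vec_nth[measurable]: "(\<lambda>x :: real ^ 'n. x $ i) \<in> borel_measurable borel"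
  by (intro borel_measurable_continuous_onI continuous_intros)

section \<open>The market model and the quadratic form of one period\<close>

locale portfolio = prob_space M
  for M :: "'a measure" +
  fixes F :: "nat \<Rightarrow> 'a measure"
    and X :: "nat \<Rightarrow> 'a \<Rightarrow> real ^ 'k"
    and r :: "nat \<Rightarrow> real"
    and \<mu> :: "nat \<Rightarrow> real ^ 'k"
    and \<Sigma> :: "nat \<Rightarrow> real ^ 'k ^ 'k"
    and \<alpha> :: real
    and T :: nat
  assumes filtration: "filtration (space M) F"
    and subalg: "\<And>\<tau>. subalgebra M (F \<tau>)"
    and X_F: "\<And>\<tau>. \<tau> \<le> T \<Longrightarrow> X \<tau> \<in> borel_measurable (F \<tau>)"
    and indep: "\<And>\<tau>. \<tau> \<in> {1..T} \<Longrightarrow>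
           indep_set (sets (F (\<tau> - 1))) (sets (vimage_algebra (space M) (X \<tau>) borel))"
    and X_square: "\<And>\<tau> i. \<tau> \<le> T \<Longrightarrow> integrable M (\<lambda>\<omega>. (X \<tau> \<omega> $ i)\<^sup>2)"
    and mean: "\<And>\<tau>. \<tau> \<le> T \<Longrightarrow> (\<integral>\<omega>. X \<tau> \<omega> \<partial>M) = \<mu> \<tau>"
    and cov: "\<And>\<tau>. \<tau> \<le> T \<Longrightarrow> covariance_matrix M (X \<tau>) = \<Sigma> \<tau>"
    and pos_def: "\<And>\<tau>. \<tau> \<le> T \<Longrightarrow> positive_definite (\<Sigma> \<tau>)"
    and gross_nonzero: "\<And>\<tau>. \<tau> \<in> {1..T} \<Longrightarrow> 1 + r \<tau> \<noteq> 0"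
    and alpha_pos: "\<alpha> > 0"
begin

sublocale finite_measure_subalgebra M "F n" for n
  by unfold_locales (rule subalg)

abbreviation "m \<equiv> excess_mean r \<mu>"
abbreviation "h \<equiv> hedge r \<mu> \<Sigma>"
abbreviation "s \<equiv> sharpe2 r \<mu> \<Sigma>"
abbreviation "Q \<equiv> second_moment r \<mu> \<Sigma>"
abbreviation "b \<equiv> bliss r \<alpha> T"
abbreviation "c \<equiv> loss_coeff r \<mu> \<Sigma> \<alpha> T"
abbreviation "R \<equiv> gross_return r X"

definition quad_loss :: "nat \<Rightarrow> real \<Rightarrow> real" where
  "quad_loss n y = c n * (y - b n)\<^sup>2"

text \<open>Zero wealth stays zero, so the optimal loss jumps there.\<close>

definition opt_loss :: "nat \<Rightarrow> real \<Rightarrow> real" where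
  "opt_loss n y = (if y = 0 then 1 / (2 * \<alpha>) else quad_loss n y)"

lemma F_mono: "n \<le> k \<Longrightarrow> subalgebra (F k) (F n)"
  using filtration by (auto simp: subalgebra_def filtration_def)

lemma measurable_F_mono: "f \<in> measurable (F n) N \<Longrightarrow> n \<le> k \<Longrightarrow> f \<in> measurable (F k) N"
  by (rule measurable_from_subalg[OF F_mono])

lemma measurable_F_M: "f \<in> measurable (F n) N \<Longrightarrow> f \<in> measurable M N"
  by (rule measurable_from_subalg[OF subalg])

lemma X_meas: "\<tau> \<le> T \<Longrightarrow> X \<tau> \<in> borel_measurable M"
  by (rule measurable_F_M[OF X_F])

lemma Sigma_hedge: "\<tau> \<le> T \<Longrightarrow> \<Sigma> \<tau> *v h \<tau> = m \<tau>"
  unfolding hedge_def by (rule positive_definite_matrix_inv[OF pos_def])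

lemma Sigma_nonneg: "\<tau> \<le> T \<Longrightarrow> 0 \<le> u \<bullet> (\<Sigma> \<tau> *v u)"
  using pos_def[of \<tau>] unfolding positive_definite_def
  by (cases "u = 0") (auto intro: less_imp_le)

lemma sharpe2_nonneg: "\<tau> \<le> T \<Longrightarrow> 0 \<le> s \<tau>"
  using Sigma_nonneg[of \<tau> "h \<tau>"] by (simp add: Sigma_hedge sharpe2_def inner_commute)

lemma second_moment_nonneg: "\<tau> \<le> T \<Longrightarrow> 0 \<le> Q \<tau> u"
  using Sigma_nonneg[of \<tau> u] by (simp add: second_moment_def)

text \<open>This definiteness is the source of uniqueness of the optimal weights.\<close>

lemma second_moment_eq_0: "\<tau> \<le> T \<Longrightarrow> Q \<tau> u \<le> 0 \<Longrightarrow> u = 0"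
  using pos_def[of \<tau>] zero_le_power2[of "u \<bullet> m \<tau>"]
  unfolding positive_definite_def second_moment_def by (metis add_pos_nonneg not_less)

lemma second_moment_hedge: "\<tau> \<le> T \<Longrightarrow> Q \<tau> (k *\<^sub>R h \<tau>) = k\<^sup>2 * (s \<tau> * (1 + s \<tau>))"
  by (simp add: second_moment_def matrix_vector_mult_scaleR Sigma_hedge sharpe2_def
      inner_commute power2_eq_square algebra_simps)

text \<open>\<open>Q\<close> is the form of the matrix \<Sigma> + m m', which maps \<open>h\<close>
  to \<open>(1 + s) m\<close>. Hence the left-hand side is stationary in \<open>u\<close> at minus
  \<open>a / (1 + s)\<close> times \<open>h\<close>, with minimum
  \<open>a\<^sup>2 / (1 + s)\<close>.\<close>

lemma complete_square:
  assumes "\<tau> \<le> T"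
  shows "(a + u \<bullet> m \<tau>)\<^sup>2 + u \<bullet> (\<Sigma> \<tau> *v u)
    = a\<^sup>2 / (1 + s \<tau>) + Q \<tau> (u + (a / (1 + s \<tau>)) *\<^sub>R h \<tau>)"
proof -
  define k where "k = a / (1 + s \<tau>)"
  have a: "a = k * (1 + s \<tau>)"
    using sharpe2_nonneg[OF assms] by (simp add: k_def)
  have hu: "(\<Sigma> \<tau> *v u) \<bullet> h \<tau> = u \<bullet> m \<tau>"
    using positive_definite_sym[OF pos_def[OF assms], of u "h \<tau>"] by (simp add: Sigma_hedge assms)
  have sq: "a\<^sup>2 / (1 + s \<tau>) = k\<^sup>2 * (1 + s \<tau>)"
    using sharpe2_nonneg[OF assms] by (simp add: k_def power2_eq_square)
  have hm: "h \<tau> \<bullet> m \<tau> = s \<tau>" by (simp add: sharpe2_def inner_commute)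
  have "(u + k *\<^sub>R h \<tau>) \<bullet> (\<Sigma> \<tau> *v (u + k *\<^sub>R h \<tau>))
      = u \<bullet> (\<Sigma> \<tau> *v u) + 2 * k * (u \<bullet> m \<tau>) + k\<^sup>2 * s \<tau>"
    using hu hm by (simp add: matrix_vector_right_distrib matrix_vector_mult_scaleR Sigma_hedge assms
        inner_add_left inner_add_right inner_commute[of "h \<tau>" "\<Sigma> \<tau> *v u"] power2_eq_square algebra_simps)
  moreover have "(u + k *\<^sub>R h \<tau>) \<bullet> m \<tau> = u \<bullet> m \<tau> + k * s \<tau>"
    using hm by (simp add: inner_add_left)
  moreover have "(a + v)\<^sup>2 + q = k\<^sup>2 * (1 + s \<tau>) + (q + 2 * k * v + k\<^sup>2 * s \<tau> + (v + k * s \<tau>)\<^sup>2)"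
    for v q
    unfolding a by (simp add: power2_eq_square algebra_simps)
  ultimately show ?thesis
    unfolding sq k_def[symmetric] second_moment_def by simp
qed

section \<open>First and second moments of the returns\<close>

lemma X_integrable: "\<tau> \<le> T \<Longrightarrow> integrable M (\<lambda>\<omega>. X \<tau> \<omega> $ i)"
  by (rule square_integrable_imp_integrable[OF _ X_square]) (rule measurable_compose[OF X_meas measurable_vec_nth])

text \<open>The mean is given as an integral of a vector. Reassembling the integrable coordinates
  along the basis makes the vector integrable, so projections commute with its integral.\<close>

lemma X_mean_nth:
  assumes "\<tau> \<le> T"
  shows "(\<integral>\<omega>. X \<tau> \<omega> $ i \<partial>M) = \<mu> \<tau> $ i"
proof -
  have "integrable M (\<lambda>\<omega>. \<Sum>i\<in>UNIV. (X \<tau> \<omega> $ i) *\<^sub>R (axis i 1 :: real ^ 'k))"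
    using X_integrable[OF assms] by (intro Bochner_Integration.integrable_sum) auto
  moreover have "(\<Sum>i\<in>UNIV. (x $ i) *\<^sub>R axis i 1) = x" for x :: "real ^ 'k"
    using basis_expansion[of x] by (simp add: scalar_mult_eq_scaleR)
  ultimately have "integrable M (X \<tau>)" by simp
  then show ?thesis
    using integral_bounded_linear[OF bounded_linear_vec_nth, of M "X \<tau>" i] mean[OF assms] by simp
qed

text \<open>After centring every coordinate, the square splits into a constant, a linear term of
  mean zero and a double sum whose integrals are the covariances.\<close>

lemma moments:
  assumes \<tau>: "\<tau> \<le> T"
  shows "integrable M (\<lambda>\<omega>. (a + u \<bullet> (X \<tau> \<omega> - r \<tau> *\<^sub>R 1))\<^sup>2)"
    and "(\<integral>\<omega>. (a + u \<bullet> (X \<tau> \<omega> - r \<tau> *\<^sub>R 1))\<^sup>2 \<partial>M) = (a + u \<bullet> m \<tau>)\<^sup>2 + u \<bullet> (\<Sigma> \<tau> *v u)"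
proof -
  define D where "D i \<omega> = X \<tau> \<omega> $ i - \<mu> \<tau> $ i" for i \<omega>
  define e where "e = a + u \<bullet> m \<tau>"
  have [measurable]: "X \<tau> \<in> borel_measurable M" by (rule X_meas[OF \<tau>])
  have [measurable]: "D i \<in> borel_measurable M" for i unfolding D_def
    by (intro borel_measurable_diff measurable_compose[OF X_meas[OF \<tau>] measurable_vec_nth]) simp
  have D: "integrable M (D i)" for i
    unfolding D_def using X_integrable[OF \<tau>] by auto
  have D0: "(\<integral>\<omega>. D i \<omega> \<partial>M) = 0" for i
    unfolding D_def using X_integrable[OF \<tau>] by (simp add: X_mean_nth[OF \<tau>] prob_space)
  have D2: "integrable M (\<lambda>\<omega>. (D i \<omega>)\<^sup>2)" for i
    unfolding D_def power2_diff using X_integrable[OF \<tau>] X_square[OF \<tau>] by auto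
  have DD: "integrable M (\<lambda>\<omega>. D i \<omega> * D j \<omega>)" for i j
  proof (rule Bochner_Integration.integrable_bound)
    show "integrable M (\<lambda>\<omega>. (D i \<omega>)\<^sup>2 + (D j \<omega>)\<^sup>2)" using D2 by auto
    have "\<bar>x * y\<bar> \<le> x\<^sup>2 + y\<^sup>2" for x y :: real
      using sum_squares_bound[of x y] sum_squares_bound[of x "- y"] by (simp add: abs_le_iff)
    then show "AE \<omega> in M. norm (D i \<omega> * D j \<omega>) \<le> norm ((D i \<omega>)\<^sup>2 + (D j \<omega>)\<^sup>2)" by simp
  qed simp
  have S: "(\<integral>\<omega>. D i \<omega> * D j \<omega> \<partial>M) = \<Sigma> \<tau> $ i $ j" for i j
    unfolding D_def cov[OF \<tau>, symmetric] covariance_matrix_def by (simp add: X_mean_nth[OF \<tau>])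
  have uD: "u \<bullet> (X \<tau> \<omega> - r \<tau> *\<^sub>R 1) = u \<bullet> m \<tau> + (\<Sum>i\<in>UNIV. u $ i * D i \<omega>)" for \<omega>
    unfolding inner_vec_def D_def excess_mean_def
    by (simp add: sum.distrib[symmetric] algebra_simps)
  have sq: "(a + u \<bullet> (X \<tau> \<omega> - r \<tau> *\<^sub>R 1))\<^sup>2 = e\<^sup>2 + 2 * e * (\<Sum>i\<in>UNIV. u $ i * D i \<omega>)
      + (\<Sum>i\<in>UNIV. \<Sum>j\<in>UNIV. u $ i * u $ j * (D i \<omega> * D j \<omega>))" for \<omega>
  proof -
    have "(\<Sum>i\<in>UNIV. u $ i * D i \<omega>)\<^sup>2 = (\<Sum>i\<in>UNIV. \<Sum>j\<in>UNIV. u $ i * u $ j * (D i \<omega> * D j \<omega>))"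
      by (simp add: power2_eq_square sum_product mult_ac)
    then show ?thesis
      unfolding uD e_def by (simp add: power2_eq_square algebra_simps)
  qed
  show "integrable M (\<lambda>\<omega>. (a + u \<bullet> (X \<tau> \<omega> - r \<tau> *\<^sub>R 1))\<^sup>2)"
    unfolding sq using D DD by auto
  have "(\<integral>\<omega>. (a + u \<bullet> (X \<tau> \<omega> - r \<tau> *\<^sub>R 1))\<^sup>2 \<partial>M)
      = e\<^sup>2 + (\<Sum>i\<in>UNIV. \<Sum>j\<in>UNIV. u $ i * u $ j * \<Sigma> \<tau> $ i $ j)"
    unfolding sq using D DD by (simp add: D0 S prob_space)
  also have "(\<Sum>i\<in>UNIV. \<Sum>j\<in>UNIV. u $ i * u $ j * \<Sigma> \<tau> $ i $ j) = u \<bullet> (\<Sigma> \<tau> *v u)"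
    by (simp add: inner_vec_def matrix_vector_mult_def sum_distrib_left mult_ac)
  finally show "(\<integral>\<omega>. (a + u \<bullet> (X \<tau> \<omega> - r \<tau> *\<^sub>R 1))\<^sup>2 \<partial>M) = (a + u \<bullet> m \<tau>)\<^sup>2 + u \<bullet> (\<Sigma> \<tau> *v u)"
    by (simp add: e_def)
qed

section \<open>Backward recursion of the losses\<close>

lemma bliss_step:
  assumes "n < T"
  shows "b (Suc n) = (1 + r (Suc n)) * b n"
proof -
  have "{n+1..T} = insert (Suc n) {Suc n+1..T}" using assms by auto
  then show ?thesis using gross_nonzero[of "Suc n"] assms by (simp add: bliss_def)
qed

lemma loss_coeff_step:
  assumes "n < T"
  shows "c n = c (Suc n) * ((1 + r (Suc n))\<^sup>2 / (1 + s (Suc n)))"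
proof -
  have "{n+1..T} = insert (Suc n) {Suc n+1..T}" using assms by auto
  then show ?thesis by (simp add: loss_coeff_def)
qed

lemma loss_coeff_pos: "0 < c n"
  unfolding loss_coeff_def using alpha_pos gross_nonzero sharpe2_nonneg
  by (auto intro!: mult_pos_pos prod_pos divide_pos_pos add_pos_nonneg)

lemma quad_loss_nonneg: "0 \<le> quad_loss n y"
  using loss_coeff_pos[of n] by (simp add: quad_loss_def)

text \<open>The right-hand side is \<open>c (Suc n)\<close> times the minimum left over by
  \<open>complete_square\<close> for the offset
  \<open>a = y * (1 + r (Suc n)) - b (Suc n)\<close>.\<close>

lemma quad_loss_step:
  assumes "n < T"
  shows "quad_loss n y = c (Suc n) * (y * (1 + r (Suc n)) - b (Suc n))\<^sup>2 / (1 + s (Suc n))"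
  unfolding quad_loss_def bliss_step[OF assms] loss_coeff_step[OF assms]
  by (simp add: power2_eq_square algebra_simps)

lemma quad_loss_T: "quad_loss T y = 1 / (2 * \<alpha>) - quadratic_utility \<alpha> y"
  using alpha_pos by (simp add: quad_loss_def loss_coeff_def bliss_def quadratic_utility_def
      power2_eq_square field_simps)

text \<open>At zero wealth each step backwards only divides the loss by \<open>1 + s\<close>, which
  is at least 1, starting from the terminal loss 1/(2\<alpha>). This makes \<open>opt_loss\<close>
  dominate \<open>quad_loss\<close>.\<close>

lemma quad_loss_0_le: "n \<le> T \<Longrightarrow> quad_loss n 0 \<le> 1 / (2 * \<alpha>)"
proof (induction rule: inc_induct)
  case base
  then show ?case by (simp add: quad_loss_T quadratic_utility_def)
next
  case (step n)
  have "quad_loss n 0 = quad_loss (Suc n) 0 / (1 + s (Suc n))"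
    using step by (simp add: quad_loss_step) (simp add: quad_loss_def)
  also have "\<dots> \<le> quad_loss (Suc n) 0"
    using quad_loss_nonneg[of "Suc n" 0] sharpe2_nonneg[of "Suc n"] step
    by (simp add: divide_le_eq mult_le_cancel_left1)
  finally show ?case using step by simp
qed

lemma opt_loss_nonneg: "0 \<le> opt_loss n y"
  using alpha_pos by (simp add: opt_loss_def quad_loss_nonneg)

lemma quad_le_opt_loss: "n \<le> T \<Longrightarrow> quad_loss n y \<le> opt_loss n y"
  by (simp add: opt_loss_def quad_loss_0_le)

lemma opt_loss_T: "opt_loss T = quad_loss T"
  by (auto simp: opt_loss_def quad_loss_T quadratic_utility_def)

lemma measurable_quad_loss[measurable]: "quad_loss n \<in> borel_measurable borel"
  unfolding quad_loss_def by measurable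

lemma measurable_opt_loss[measurable]: "opt_loss n \<in> borel_measurable borel"
  unfolding opt_loss_def by measurable

text \<open>The invested amounts \<open>y *\<^sub>R u\<close> are the natural decision variable: the
  next deviation from bliss is affine in them, so \<open>complete_square\<close> applies.\<close>

lemma expected_quad_loss:
  assumes n: "n < T"
  shows "(\<integral>\<^sup>+\<omega>. ennreal (quad_loss (Suc n) (y * R (Suc n) (\<lambda>_. u) \<omega>)) \<partial>M)
    = ennreal (quad_loss n y + c (Suc n) * Q (Suc n)
        (y *\<^sub>R u + ((y * (1 + r (Suc n)) - b (Suc n)) / (1 + s (Suc n))) *\<^sub>R h (Suc n)))"
proof -
  define a where "a = y * (1 + r (Suc n)) - b (Suc n)"
  have eq: "quad_loss (Suc n) (y * R (Suc n) (\<lambda>_. u) \<omega>)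
      = c (Suc n) * (a + (y *\<^sub>R u) \<bullet> (X (Suc n) \<omega> - r (Suc n) *\<^sub>R 1))\<^sup>2" for \<omega>
    by (simp add: quad_loss_def gross_return_def a_def algebra_simps)
  have sn: "Suc n \<le> T" using n by simp
  have "(\<integral>\<^sup>+\<omega>. ennreal (quad_loss (Suc n) (y * R (Suc n) (\<lambda>_. u) \<omega>)) \<partial>M)
      = ennreal (\<integral>\<omega>. c (Suc n) * (a + (y *\<^sub>R u) \<bullet> (X (Suc n) \<omega> - r (Suc n) *\<^sub>R 1))\<^sup>2 \<partial>M)"
    unfolding eq using loss_coeff_pos[of "Suc n"]
    by (intro nn_integral_eq_integral integrable_mult_right moments(1)[OF sn] AE_I2 mult_nonneg_nonneg) auto
  also have "(\<integral>\<omega>. c (Suc n) * (a + (y *\<^sub>R u) \<bullet> (X (Suc n) \<omega> - r (Suc n) *\<^sub>R 1))\<^sup>2 \<partial>M)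
      = c (Suc n) * (a\<^sup>2 / (1 + s (Suc n)) + Q (Suc n) (y *\<^sub>R u + (a / (1 + s (Suc n))) *\<^sub>R h (Suc n)))"
    by (simp only: integral_mult_right_zero moments(2)[OF sn] complete_square[OF sn])
  finally show ?thesis
    by (simp add: quad_loss_step[OF n] a_def distrib_left)
qed

lemma opt_loss_le_expected:
  assumes n: "n < T"
  shows "ennreal (opt_loss n y) \<le> (\<integral>\<^sup>+\<omega>. ennreal (opt_loss (Suc n) (y * R (Suc n) (\<lambda>_. u) \<omega>)) \<partial>M)"
proof (cases "y = 0")
  case True
  \<comment> \<open>From zero wealth the next wealth is zero too, so both sides equal
    1/(2\<alpha>).\<close>
  then show ?thesis by (simp add: opt_loss_def emeasure_space_1)
next
  case False
  then have "ennreal (opt_loss n y) \<le> (\<integral>\<^sup>+\<omega>. ennreal (quad_loss (Suc n) (y * R (Suc n) (\<lambda>_. u) \<omega>)) \<partial>M)"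
    unfolding expected_quad_loss[OF n] opt_loss_def
    using n loss_coeff_pos[of "Suc n"] second_moment_nonneg[of "Suc n"]
    by (auto intro!: ennreal_leI)
  also have "\<dots> \<le> (\<integral>\<^sup>+\<omega>. ennreal (opt_loss (Suc n) (y * R (Suc n) (\<lambda>_. u) \<omega>)) \<partial>M)"
    using n by (intro nn_integral_mono ennreal_leI quad_le_opt_loss) simp
  finally show ?thesis .
qed

section \<open>Conditional expected loss\<close>

lemma measurable_gross_return:
  assumes "\<tau> \<le> T" "v \<in> borel_measurable (F n)" "n \<le> \<tau>"
  shows "R \<tau> v \<in> borel_measurable (F \<tau>)"
proof -
  have [measurable]: "v \<in> borel_measurable (F \<tau>)" "X \<tau> \<in> borel_measurable (F \<tau>)"
    using assms measurable_F_mono X_F by auto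
  show ?thesis unfolding gross_return_def by measurable
qed

lemma measurable_next_wealth:
  assumes "n < T" "Y \<in> borel_measurable (F n)" "v \<in> borel_measurable (F n)"
  shows "(\<lambda>\<omega>. Y \<omega> * R (Suc n) v \<omega>) \<in> borel_measurable (F (Suc n))"
proof (rule borel_measurable_times)
  show "Y \<in> borel_measurable (F (Suc n))"
    by (rule measurable_F_mono[OF assms(2)]) simp
  show "R (Suc n) v \<in> borel_measurable (F (Suc n))"
    by (rule measurable_gross_return[OF _ assms(3)]) (use assms(1) in auto)
qed

lemma measurable_wealth:
  assumes "w \<in> strategies F n T" "Y \<in> borel_measurable (F n)"
  shows "n + j \<le> T \<Longrightarrow> wealth r X n Y w j \<in> borel_measurable (F (n + j))"
proof (induction j)
  case 0
  then show ?case using assms by simp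
next
  case (Suc j)
  then show ?case
    using measurable_next_wealth[of "n + j" "wealth r X n Y w j" "w (n + j)"] assms(1)
    by (simp add: strategies_def)
qed

text \<open>Besides the next wealth, \<open>g\<close> sees the current one;
  \<open>near_optimal_weights\<close> uses this to treat zero current wealth separately.\<close>

lemma cond_exp_next_wealth:
  fixes g :: "real \<Rightarrow> real \<Rightarrow> ennreal"
  assumes n: "n < T"
    and Y[measurable]: "Y \<in> borel_measurable (F n)"
    and v[measurable]: "v \<in> borel_measurable (F n)"
    and g[measurable]: "(\<lambda>(y, z). g y z) \<in> borel_measurable (borel \<Otimes>\<^sub>M borel)"
  shows "AE \<omega> in M. nn_cond_exp M (F n) (\<lambda>\<omega>. g (Y \<omega>) (Y \<omega> * R (Suc n) v \<omega>)) \<omega>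
    = (\<integral>\<^sup>+x. g (Y \<omega>) (Y \<omega> * R (Suc n) (\<lambda>_. v \<omega>) x) \<partial>M)"
proof -
  have indep_n: "indep_set (sets (F n)) (sets (vimage_algebra (space M) (X (Suc n)) borel))"
    using indep[of "Suc n"] n by simp
  have X_n: "X (Suc n) \<in> borel_measurable M" using X_meas n by simp
  let ?f = "\<lambda>\<omega> x. g (Y \<omega>) (Y \<omega> * ((1 + r (Suc n)) + v \<omega> \<bullet> (x - r (Suc n) *\<^sub>R 1)))"
  have "(\<lambda>(\<omega>, x). ?f \<omega> x) \<in> borel_measurable (F n \<Otimes>\<^sub>M borel)"
    by measurable
  from nn_cond_exp_freeze[OF subalg X_n indep_n this]
  show ?thesis by (simp add: gross_return_def)
qed

lemma opt_loss_le_cond_exp: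
  assumes "n < T" "Y \<in> borel_measurable (F n)" "v \<in> borel_measurable (F n)"
  shows "AE \<omega> in M. ennreal (opt_loss n (Y \<omega>))
    \<le> nn_cond_exp M (F n) (\<lambda>\<omega>. ennreal (opt_loss (Suc n) (Y \<omega> * R (Suc n) v \<omega>))) \<omega>"
  using cond_exp_next_wealth[OF assms, of "\<lambda>_ z. ennreal (opt_loss (Suc n) z)"]
  by (auto simp: opt_loss_le_expected[OF assms(1)])

text \<open>Backward induction with the tower property. The initial wealth stays arbitrary so that
  the hypothesis applies to the wealth after one period.\<close>

lemma opt_loss_le_terminal:
  assumes "n \<le> T" "Y \<in> borel_measurable (F n)" "w \<in> strategies F n T"
  shows "AE \<omega> in M. ennreal (opt_loss n (Y \<omega>))
    \<le> nn_cond_exp M (F n) (\<lambda>\<omega>. ennreal (quad_loss T (wealth r X n Y w (T - n) \<omega>))) \<omega>"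
  using assms
proof (induction arbitrary: Y rule: inc_induct)
  case base
  have "AE \<omega> in M. ennreal (quad_loss T (Y \<omega>)) = nn_cond_exp M (F T) (\<lambda>\<omega>. ennreal (quad_loss T (Y \<omega>))) \<omega>"
    using base by (intro nn_cond_exp_F_meas) measurable
  then show ?case by (auto simp: opt_loss_T)
next
  case (step n)
  let ?Y = "\<lambda>\<omega>. Y \<omega> * R (Suc n) (w n) \<omega>"
  let ?L = "\<lambda>\<omega>. ennreal (quad_loss T (wealth r X n Y w (T - n) \<omega>))"
  have w: "w n \<in> borel_measurable (F n)" "w \<in> strategies F (Suc n) T"
    using step by (auto simp: strategies_def)
  have Y: "?Y \<in> borel_measurable (F (Suc n))"
    using step w by (intro measurable_next_wealth)
  have [measurable]: "?Y \<in> borel_measurable M" by (rule measurable_F_M[OF Y])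
  have [measurable]: "wealth r X n Y w (T - n) \<in> borel_measurable M"
    using measurable_F_M[OF measurable_wealth[of w n Y "T - n"]] step by simp
  have "wealth r X n Y w (T - n) = wealth r X (Suc n) ?Y w (T - Suc n)"
    using wealth_Suc_shift[of r X n Y w "T - Suc n"] step by (simp add: Suc_diff_Suc)
  then have IH: "AE \<omega> in M. ennreal (opt_loss (Suc n) (?Y \<omega>)) \<le> nn_cond_exp M (F (Suc n)) ?L \<omega>"
    using step.IH[OF Y w(2)] by simp
  have "AE \<omega> in M. nn_cond_exp M (F n) (\<lambda>\<omega>. ennreal (opt_loss (Suc n) (?Y \<omega>))) \<omega>
      \<le> nn_cond_exp M (F n) (nn_cond_exp M (F (Suc n)) ?L) \<omega>"
    by (rule nn_cond_exp_mono[OF IH]) auto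
  moreover have "AE \<omega> in M. nn_cond_exp M (F n) ?L \<omega> = nn_cond_exp M (F n) (nn_cond_exp M (F (Suc n)) ?L) \<omega>"
    by (rule nn_cond_exp_nested_subalg[OF subalg F_mono]) auto
  moreover have "AE \<omega> in M. ennreal (opt_loss n (Y \<omega>))
      \<le> nn_cond_exp M (F n) (\<lambda>\<omega>. ennreal (opt_loss (Suc n) (?Y \<omega>))) \<omega>"
    using step w by (intro opt_loss_le_cond_exp)
  ultimately show ?case by eventually_elim simp
qed

section \<open>The closed-form weights and their rescalings\<close>

definition scaled_weights :: "real \<Rightarrow> nat \<Rightarrow> real \<Rightarrow> real ^ 'k" where
  "scaled_weights k n y = (k * alpha_inv \<alpha> r \<mu> \<Sigma> T (Suc n) y) *\<^sub>R h (Suc n)"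

lemma alpha_inv_eq:
  "alpha_inv \<alpha> r \<mu> \<Sigma> T \<tau> y = (b \<tau> / y - (1 + r \<tau>)) / (1 + s \<tau>)"
  by (simp add: alpha_inv_def bliss_def sharpe2_def hedge_def)

lemma measurable_scaled_weights[measurable]: "scaled_weights k n \<in> borel_measurable borel"
  unfolding scaled_weights_def alpha_inv_def by measurable

text \<open>The deviation from the minimising amounts is proportional to \<open>1 - k\<close>: it
  vanishes for the claimed optimum \<open>k = 1\<close> and is small for \<open>k\<close> near
  1.\<close>

lemma scale_scaled_weights:
  assumes "y \<noteq> 0"
  shows "y *\<^sub>R scaled_weights k n y + ((y * (1 + r (Suc n)) - b (Suc n)) / (1 + s (Suc n))) *\<^sub>R h (Suc n)
    = ((1 - k) * ((y * (1 + r (Suc n)) - b (Suc n)) / (1 + s (Suc n)))) *\<^sub>R h (Suc n)"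
proof -
  have "y * (k * alpha_inv \<alpha> r \<mu> \<Sigma> T (Suc n) y)
      = - k * ((y * (1 + r (Suc n)) - b (Suc n)) / (1 + s (Suc n)))"
  proof -
    have "y * (b (Suc n) / y - (1 + r (Suc n))) = - (y * (1 + r (Suc n)) - b (Suc n))"
      using assms by (simp add: right_diff_distrib)
    then show ?thesis
      unfolding alpha_inv_eq by (metis (no_types, lifting) mult.left_commute mult_minus_left mult_minus_right times_divide_eq_right)
  qed
  then have "y *\<^sub>R scaled_weights k n y
      = (- k * ((y * (1 + r (Suc n)) - b (Suc n)) / (1 + s (Suc n)))) *\<^sub>R h (Suc n)"
    by (simp only: scaled_weights_def scaleR_scaleR)
  moreover have "(- k * x) *\<^sub>R h (Suc n) + x *\<^sub>R h (Suc n) = ((1 - k) * x) *\<^sub>R h (Suc n)" for x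
    by (simp add: algebra_simps)
  ultimately show ?thesis by (simp only:)
qed

text \<open>Rescaling by \<open>k\<close> costs a relative amount
  \<open>(1 - k)\<^sup>2 * s\<close>, the same at every nonzero wealth.\<close>

lemma expected_scaled_weights:
  assumes n: "n < T" and y: "y \<noteq> 0"
  shows "(\<integral>\<^sup>+\<omega>. ennreal (quad_loss (Suc n) (y * R (Suc n) (\<lambda>_. scaled_weights k n y) \<omega>)) \<partial>M)
    = ennreal ((1 + (1 - k)\<^sup>2 * s (Suc n)) * quad_loss n y)"
proof -
  have s: "1 + s (Suc n) \<noteq> 0" "Suc n \<le> T" using sharpe2_nonneg[of "Suc n"] n by auto
  define a where "a = y * (1 + r (Suc n)) - b (Suc n)"
  have "c (Suc n) * Q (Suc n) (((1 - k) * (a / (1 + s (Suc n)))) *\<^sub>R h (Suc n))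
      = (1 - k)\<^sup>2 * s (Suc n) * (c (Suc n) * a\<^sup>2 / (1 + s (Suc n)))"
  proof -
    have "((1 - k) * (a / d))\<^sup>2 * (x * d) = (1 - k)\<^sup>2 * x * (a\<^sup>2 / d)" if "d \<noteq> 0" for d x
      using that by (simp add: power2_eq_square)
    from this[OF s(1)] show ?thesis unfolding second_moment_hedge[OF s(2)] by simp
  qed
  then have "c (Suc n) * Q (Suc n) (((1 - k) * (a / (1 + s (Suc n)))) *\<^sub>R h (Suc n))
      = (1 - k)\<^sup>2 * s (Suc n) * quad_loss n y"
    unfolding quad_loss_step[OF n] a_def .
  then show ?thesis
    unfolding expected_quad_loss[OF n] scale_scaled_weights[OF y]
    unfolding a_def[symmetric] by (simp only: distrib_right mult_1)
qed

text \<open>The hypothesis leaves no room for the \<open>Q\<close> term, whose argument must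
  therefore vanish. The weights with \<open>k = 1\<close> solve the same equation, and dividing by
  \<open>y\<close> identifies the two.\<close>

lemma expected_quad_loss_minimizer:
  assumes n: "n < T" and y: "y \<noteq> 0"
    and le: "(\<integral>\<^sup>+\<omega>. ennreal (quad_loss (Suc n) (y * R (Suc n) (\<lambda>_. u) \<omega>)) \<partial>M) \<le> ennreal (quad_loss n y)"
  shows "u = scaled_weights 1 n y"
proof -
  let ?d = "((y * (1 + r (Suc n)) - b (Suc n)) / (1 + s (Suc n))) *\<^sub>R h (Suc n)"
  have sn: "Suc n \<le> T" using n by simp
  have "c (Suc n) * Q (Suc n) (y *\<^sub>R u + ?d) \<le> 0"
    using le unfolding expected_quad_loss[OF n] by (subst (asm) ennreal_le_iff) (auto simp: quad_loss_nonneg)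
  then have "Q (Suc n) (y *\<^sub>R u + ?d) \<le> 0"
    using loss_coeff_pos[of "Suc n"] by (simp add: mult_le_0_iff)
  then have "y *\<^sub>R u + ?d = y *\<^sub>R scaled_weights 1 n y + ?d"
    using second_moment_eq_0[OF sn] scale_scaled_weights[OF y, of 1 n] by simp
  then show ?thesis using y by simp
qed

text \<open>For nonzero wealth, the events that the next wealth vanishes are disjoint for different factors \<open>k > 0\<close>.\<close>

lemma scaled_weights_avoid_zero:
  assumes n: "n < T" and [measurable]: "Y \<in> borel_measurable M" and \<epsilon>: "0 < \<epsilon>"
  shows "\<exists>k\<in>{1<..<1 + \<epsilon>}. AE \<omega> in M. Y \<omega> \<noteq> 0 \<longrightarrow>
    Y \<omega> * R (Suc n) (\<lambda>\<omega>. scaled_weights k n (Y \<omega>)) \<omega> \<noteq> 0"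
proof -
  define Z where "Z \<omega> = scaled_weights 1 n (Y \<omega>) \<bullet> (X (Suc n) \<omega> - r (Suc n) *\<^sub>R 1)" for \<omega>
  \<comment> \<open>The gross return for the factor \<open>k\<close> is
    \<open>1 + r (Suc n) + k * Z\<close>, so it vanishes exactly where
    \<open>Z = f k\<close>.\<close>
  define f where "f k = - (1 + r (Suc n)) / k" for k :: real
  have R0: "1 + r (Suc n) \<noteq> 0" using gross_nonzero[of "Suc n"] n by simp
  have [measurable]: "X (Suc n) \<in> borel_measurable M" using X_meas n by simp
  have [measurable]: "Z \<in> borel_measurable M" unfolding Z_def by measurable
  interpret Z: prob_space "distr M borel Z" by (rule prob_space_distr) simp
  \<comment> \<open>The law of \<open>Z\<close> has only countably many atoms, while
    \<open>f\<close> is injective on an uncountable interval; some \<open>f k\<close> is therefore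
    not an atom.\<close>
  let ?A = "{z. measure (distr M borel Z) {z} \<noteq> 0}"
  have "inj_on f {1<..<1 + \<epsilon>}"
    using R0 by (intro inj_onI) (auto simp: f_def)
  then have "uncountable (f ` {1<..<1 + \<epsilon>})"
    using uncountable_open_interval[of 1 "1 + \<epsilon>"] \<epsilon> countable_image_inj_eq by auto
  moreover have "countable ?A" using Z.countable_support .
  ultimately have "\<not> f ` {1<..<1 + \<epsilon>} \<subseteq> ?A" using countable_subset by blast
  then obtain k where "k \<in> {1<..<1 + \<epsilon>}" "f k \<notin> ?A" by blast
  then have k: "k \<in> {1<..<1 + \<epsilon>}" "measure (distr M borel Z) {f k} = 0" by auto
  have "emeasure (distr M borel Z) {f k} = 0" using k(2) by (simp add: Z.emeasure_eq_measure)
  then have "AE z in distr M borel Z. z \<noteq> f k"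
    by (subst AE_iff_measurable[of "{f k}"]) auto
  then have "AE \<omega> in M. Z \<omega> \<noteq> f k" by (subst (asm) AE_distr_iff) auto
  moreover have "R (Suc n) (\<lambda>\<omega>. scaled_weights k n (Y \<omega>)) \<omega> = 1 + r (Suc n) + k * Z \<omega>" for \<omega>
    by (simp add: gross_return_def Z_def scaled_weights_def)
  ultimately show ?thesis
  proof (intro bexI[of _ k])
    assume R: "R (Suc n) (\<lambda>\<omega>. scaled_weights k n (Y \<omega>)) \<omega> = 1 + r (Suc n) + k * Z \<omega>" for \<omega>
    assume "AE \<omega> in M. Z \<omega> \<noteq> f k"
    then show "AE \<omega> in M. Y \<omega> \<noteq> 0 \<longrightarrow> Y \<omega> * R (Suc n) (\<lambda>\<omega>. scaled_weights k n (Y \<omega>)) \<omega> \<noteq> 0"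
    proof eventually_elim
      case (elim \<omega>)
      have "1 + r (Suc n) + k * Z \<omega> \<noteq> 0"
      proof
        assume "1 + r (Suc n) + k * Z \<omega> = 0"
        then have "Z \<omega> * k = - (1 + r (Suc n))" by (simp add: mult.commute)
        then have "Z \<omega> = f k" unfolding f_def using k(1) by (subst eq_divide_eq) simp
        with elim show False ..
      qed
      then show ?case by (simp add: R)
    qed
  qed (rule k(1))
qed

text \<open>One factor \<open>k\<close> serves all outcomes, so the weights remain
  \<open>F n\<close>-measurable.\<close>

lemma near_optimal_weights:
  assumes n: "n < T" and Y[measurable]: "Y \<in> borel_measurable (F n)" and \<delta>: "0 < \<delta>"
  shows "\<exists>v\<in>borel_measurable (F n). AE \<omega> in M.
    nn_cond_exp M (F n) (\<lambda>\<omega>. ennreal (opt_loss (Suc n) (Y \<omega> * R (Suc n) v \<omega>))) \<omega>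
      \<le> ennreal ((1 + \<delta>) * opt_loss n (Y \<omega>))"
proof -
  have s: "0 \<le> s (Suc n)" using sharpe2_nonneg n by simp
  \<comment> \<open>The cap at 1 gives \<open>(k - 1)\<^sup>2 \<le> k - 1 < \<epsilon>\<close>; the
    quotient then bounds the relative cost \<open>(1 - k)\<^sup>2 * s (Suc n)\<close> by
    \<delta>.\<close>
  define \<epsilon> where "\<epsilon> = min 1 (\<delta> / (1 + s (Suc n)))"
  have \<epsilon>: "0 < \<epsilon>" "\<epsilon> \<le> 1" using s \<delta> by (auto simp: \<epsilon>_def)
  have "\<epsilon> \<le> \<delta> / (1 + s (Suc n))" by (simp add: \<epsilon>_def)
  then have "\<epsilon> * (1 + s (Suc n)) \<le> \<delta>" using s by (simp add: pos_le_divide_eq)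
  then have \<epsilon>s: "\<epsilon> * s (Suc n) \<le> \<delta>" using \<epsilon>(1) by (simp add: distrib_left)
  obtain k where k: "1 < k" "k < 1 + \<epsilon>"
    and ne: "AE \<omega> in M. Y \<omega> \<noteq> 0 \<longrightarrow> Y \<omega> * R (Suc n) (\<lambda>\<omega>. scaled_weights k n (Y \<omega>)) \<omega> \<noteq> 0"
    using scaled_weights_avoid_zero[OF n measurable_F_M[OF Y] \<epsilon>(1)] by auto
  have "(k - 1)\<^sup>2 \<le> \<epsilon>"
    using k \<epsilon> power_decreasing[of 1 2 "k - 1"] by simp
  then have ks: "(1 - k)\<^sup>2 * s (Suc n) \<le> \<delta>"
    using mult_right_mono[OF _ s, of "(k - 1)\<^sup>2" \<epsilon>] \<epsilon>s by (simp add: power2_commute)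
  define v where "v \<omega> = scaled_weights k n (Y \<omega>)" for \<omega>
  have v[measurable]: "v \<in> borel_measurable (F n)" unfolding v_def by measurable
  have [measurable]: "Y \<in> borel_measurable M" "(\<lambda>\<omega>. Y \<omega> * R (Suc n) v \<omega>) \<in> borel_measurable M"
    using measurable_F_M[OF Y] measurable_F_M[OF measurable_next_wealth[OF n Y v]] by auto
  \<comment> \<open>Almost surely the next wealth is zero only if the current one is. Testing the
    current wealth therefore replaces the jump of \<open>opt_loss\<close>, and the expected
    quadratic loss becomes available.\<close>
  define g where "g y z = ennreal (if y = 0 then 1 / (2 * \<alpha>) else quad_loss (Suc n) z)" for y z :: real
  have [measurable]: "(\<lambda>(y, z). g y z) \<in> borel_measurable (borel \<Otimes>\<^sub>M borel)"
    unfolding g_def by measurable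
  have bound: "(\<integral>\<^sup>+x. g y (y * R (Suc n) (\<lambda>_. scaled_weights k n y) x) \<partial>M) \<le> ennreal ((1 + \<delta>) * opt_loss n y)" for y
  proof (cases "y = 0")
    case True
    then show ?thesis using \<delta> alpha_pos
      by (auto simp: g_def opt_loss_def emeasure_space_1 intro!: ennreal_leI divide_right_mono)
  next
    case False
    then show ?thesis using ks quad_loss_nonneg[of n y]
      by (auto simp: g_def opt_loss_def expected_scaled_weights[OF n False] intro!: ennreal_leI mult_right_mono)
  qed
  have "AE \<omega> in M. nn_cond_exp M (F n) (\<lambda>\<omega>. ennreal (opt_loss (Suc n) (Y \<omega> * R (Suc n) v \<omega>))) \<omega>
      = nn_cond_exp M (F n) (\<lambda>\<omega>. g (Y \<omega>) (Y \<omega> * R (Suc n) v \<omega>)) \<omega>"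
  proof (rule nn_cond_exp_cong)
    show "AE \<omega> in M. ennreal (opt_loss (Suc n) (Y \<omega> * R (Suc n) v \<omega>)) = g (Y \<omega>) (Y \<omega> * R (Suc n) v \<omega>)"
      using ne unfolding v_def[symmetric] by eventually_elim (auto simp: opt_loss_def g_def)
  qed auto
  moreover have "AE \<omega> in M. nn_cond_exp M (F n) (\<lambda>\<omega>. g (Y \<omega>) (Y \<omega> * R (Suc n) v \<omega>)) \<omega>
      = (\<integral>\<^sup>+x. g (Y \<omega>) (Y \<omega> * R (Suc n) (\<lambda>_. v \<omega>) x) \<partial>M)"
    by (rule cond_exp_next_wealth[OF n Y v]) simp
  ultimately have "AE \<omega> in M. nn_cond_exp M (F n) (\<lambda>\<omega>. ennreal (opt_loss (Suc n) (Y \<omega> * R (Suc n) v \<omega>))) \<omega>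
      \<le> ennreal ((1 + \<delta>) * opt_loss n (Y \<omega>))"
    by eventually_elim (simp add: v_def bound)
  then show ?thesis using v by blast
qed

text \<open>Near-optimal weights for the current period are followed by a near-optimal strategy from
  the resulting wealth; the relative slacks multiply along the backward induction.\<close>

lemma near_optimal_strategy:
  assumes "n \<le> T" "Y \<in> borel_measurable (F n)" "0 < \<delta>"
  shows "\<exists>w\<in>strategies F n T. AE \<omega> in M.
    nn_cond_exp M (F n) (\<lambda>\<omega>. ennreal (quad_loss T (wealth r X n Y w (T - n) \<omega>))) \<omega>
      \<le> ennreal ((1 + \<delta>) * opt_loss n (Y \<omega>))"
  using assms
proof (induction arbitrary: Y \<delta> rule: inc_induct)
  case base
  have "AE \<omega> in M. ennreal (quad_loss T (Y \<omega>)) = nn_cond_exp M (F T) (\<lambda>\<omega>. ennreal (quad_loss T (Y \<omega>))) \<omega>"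
    using base by (intro nn_cond_exp_F_meas) measurable
  then have "AE \<omega> in M. nn_cond_exp M (F T) (\<lambda>\<omega>. ennreal (quad_loss T (Y \<omega>))) \<omega> \<le> ennreal ((1 + \<delta>) * opt_loss T (Y \<omega>))"
  proof eventually_elim
    case (elim \<omega>)
    have "ennreal (quad_loss T (Y \<omega>)) \<le> ennreal ((1 + \<delta>) * quad_loss T (Y \<omega>))"
      using base(2) quad_loss_nonneg[of T "Y \<omega>"] by (intro ennreal_leI) (simp add: distrib_right)
    then show ?case unfolding elim opt_loss_T .
  qed
  then show ?case by (auto simp: strategies_def)
next
  case (step n)
  \<comment> \<open>The slack is split evenly between the current period and the continuation, by
    way of the square root of 1 + \<delta>.\<close>
  obtain \<delta>' where \<delta>': "0 < \<delta>'" "(1 + \<delta>') * (1 + \<delta>') \<le> 1 + \<delta>"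
  proof
    have "sqrt 1 < sqrt (1 + \<delta>)" using step.prems by (intro real_sqrt_less_mono) simp
    then show "0 < sqrt (1 + \<delta>) - 1" by simp
    show "(1 + (sqrt (1 + \<delta>) - 1)) * (1 + (sqrt (1 + \<delta>) - 1)) \<le> 1 + \<delta>"
      using step.prems by simp
  qed
  obtain v where v: "v \<in> borel_measurable (F n)" and v_le: "AE \<omega> in M.
      nn_cond_exp M (F n) (\<lambda>\<omega>. ennreal (opt_loss (Suc n) (Y \<omega> * R (Suc n) v \<omega>))) \<omega>
        \<le> ennreal ((1 + \<delta>') * opt_loss n (Y \<omega>))"
    using near_optimal_weights[OF _ _ \<delta>'(1)] step by blast
  let ?Y = "\<lambda>\<omega>. Y \<omega> * R (Suc n) v \<omega>"
  have Y: "?Y \<in> borel_measurable (F (Suc n))"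
    using step v by (intro measurable_next_wealth)
  have [measurable]: "?Y \<in> borel_measurable M" by (rule measurable_F_M[OF Y])
  obtain w' where w': "w' \<in> strategies F (Suc n) T" and w'_le: "AE \<omega> in M.
      nn_cond_exp M (F (Suc n)) (\<lambda>\<omega>. ennreal (quad_loss T (wealth r X (Suc n) ?Y w' (T - Suc n) \<omega>))) \<omega>
        \<le> ennreal ((1 + \<delta>') * opt_loss (Suc n) (?Y \<omega>))"
    using step.IH[OF Y \<delta>'(1)] by blast
  \<comment> \<open>The continuation reads only weights from time \<open>Suc n\<close> on, so
    overwriting time \<open>n\<close> leaves it unchanged.\<close>
  define w where "w = w'(n := v)"
  have w: "w \<in> strategies F n T"
    using w' v by (auto simp: strategies_def w_def)
  let ?L = "\<lambda>\<omega>. ennreal (quad_loss T (wealth r X n Y w (T - n) \<omega>))"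
  have [measurable]: "wealth r X n Y w (T - n) \<in> borel_measurable M"
    using measurable_F_M[OF measurable_wealth[OF w, of Y "T - n"]] step by simp
  have "wealth r X n Y w (T - n) = wealth r X (Suc n) ?Y w (T - Suc n)"
    using wealth_Suc_shift[of r X n Y w "T - Suc n"] step by (simp add: Suc_diff_Suc w_def)
  also have "\<dots> = wealth r X (Suc n) ?Y w' (T - Suc n)"
    by (rule wealth_cong) (simp add: w_def)
  finally have IH: "AE \<omega> in M. nn_cond_exp M (F (Suc n)) ?L \<omega>
      \<le> ennreal (1 + \<delta>') * ennreal (opt_loss (Suc n) (?Y \<omega>))"
    using w'_le \<delta>'(1) by (simp add: ennreal_mult' opt_loss_nonneg)
  have "AE \<omega> in M. nn_cond_exp M (F n) (nn_cond_exp M (F (Suc n)) ?L) \<omega>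
      \<le> nn_cond_exp M (F n) (\<lambda>\<omega>. ennreal (1 + \<delta>') * ennreal (opt_loss (Suc n) (?Y \<omega>))) \<omega>"
    by (rule nn_cond_exp_mono[OF IH]) auto
  moreover have "AE \<omega> in M. nn_cond_exp M (F n) ?L \<omega> = nn_cond_exp M (F n) (nn_cond_exp M (F (Suc n)) ?L) \<omega>"
    by (rule nn_cond_exp_nested_subalg[OF subalg F_mono]) auto
  moreover have "AE \<omega> in M. ennreal (1 + \<delta>') * nn_cond_exp M (F n) (\<lambda>\<omega>. ennreal (opt_loss (Suc n) (?Y \<omega>))) \<omega>
      = nn_cond_exp M (F n) (\<lambda>\<omega>. ennreal (1 + \<delta>') * ennreal (opt_loss (Suc n) (?Y \<omega>))) \<omega>"
    by (rule nn_cond_exp_prod) auto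
  ultimately have "AE \<omega> in M. nn_cond_exp M (F n) ?L \<omega> \<le> ennreal ((1 + \<delta>) * opt_loss n (Y \<omega>))"
    using v_le
  proof eventually_elim
    case (elim \<omega>)
    have "nn_cond_exp M (F n) ?L \<omega>
        \<le> ennreal (1 + \<delta>') * nn_cond_exp M (F n) (\<lambda>\<omega>. ennreal (opt_loss (Suc n) (?Y \<omega>))) \<omega>"
      using elim by simp
    also have "\<dots> \<le> ennreal (1 + \<delta>') * ennreal ((1 + \<delta>') * opt_loss n (Y \<omega>))"
      using elim by (intro mult_left_mono) auto
    also have "\<dots> = ennreal (((1 + \<delta>') * (1 + \<delta>')) * opt_loss n (Y \<omega>))"
      using \<delta>'(1) opt_loss_nonneg[of n "Y \<omega>"] by (subst ennreal_mult[symmetric]) (auto simp: mult.assoc)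
    also have "\<dots> \<le> ennreal ((1 + \<delta>) * opt_loss n (Y \<omega>))"
      using \<delta>'(2) by (intro ennreal_leI mult_right_mono opt_loss_nonneg)
    finally show ?case .
  qed
  then show ?case using w by blast
qed

section \<open>The Bellman equation\<close>

text \<open>This identifies the value function. The lower bound on losses makes the candidate an
  upper bound; near-optimal strategies make it the least one, although none of them need attain
  it.\<close>

lemma is_ess_sup_utility:
  assumes n: "n \<le> T" and Y: "Y \<in> borel_measurable (F n)"
  shows "is_ess_sup M (F n)
    ((\<lambda>w. ereal_cond_exp M (F n)
        (\<lambda>\<omega>. ereal (quadratic_utility \<alpha> (wealth r X n Y w (T - n) \<omega>)))) ` strategies F n T)
    (\<lambda>\<omega>. ereal (1 / (2 * \<alpha>) - opt_loss n (Y \<omega>)))"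
proof -
  let ?K = "1 / (2 * \<alpha>)"
  let ?U = "\<lambda>w. ereal_cond_exp M (F n)
        (\<lambda>\<omega>. ereal (quadratic_utility \<alpha> (wealth r X n Y w (T - n) \<omega>)))"
  let ?L = "\<lambda>w. nn_cond_exp M (F n) (\<lambda>\<omega>. ennreal (quad_loss T (wealth r X n Y w (T - n) \<omega>)))"
  have U: "AE \<omega> in M. ?U w \<omega> = ereal ?K - enn2ereal (?L w \<omega>)" if w: "w \<in> strategies F n T" for w
  proof -
    have [measurable]: "wealth r X n Y w (T - n) \<in> borel_measurable M"
      using measurable_F_M[OF measurable_wealth[OF w Y, of "T - n"]] n by simp
    have "AE \<omega> in M. ereal_cond_exp M (F n) (\<lambda>\<omega>. ereal (?K - quad_loss T (wealth r X n Y w (T - n) \<omega>))) \<omega>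
        = ereal ?K - enn2ereal (?L w \<omega>)"
      using alpha_pos quad_loss_nonneg by (intro ereal_cond_exp_const_diff) auto
    then show ?thesis by (simp add: quad_loss_T)
  qed
  show ?thesis
    unfolding is_ess_sup_def
  proof (intro conjI ballI impI)
    show "(\<lambda>\<omega>. ereal (?K - opt_loss n (Y \<omega>))) \<in> borel_measurable (F n)"
      using Y by measurable
  next
    fix f assume "f \<in> ?U ` strategies F n T"
    then obtain w where w: "w \<in> strategies F n T" "f = ?U w" by auto
    from U[OF w(1)] opt_loss_le_terminal[OF n Y w(1)]
    show "AE \<omega> in M. f \<omega> \<le> ereal (?K - opt_loss n (Y \<omega>))"
    proof eventually_elim
      case (elim \<omega>)
      have "f \<omega> \<le> ereal ?K - enn2ereal (ennreal (opt_loss n (Y \<omega>)))"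
        unfolding w(2) elim(1) by (simp only: ereal_const_diff_le_iff elim(2))
      then show ?case by (simp add: opt_loss_nonneg)
    qed
  next
    fix u assume "u \<in> borel_measurable (F n)" and ub: "\<forall>f\<in>?U ` strategies F n T. AE \<omega> in M. f \<omega> \<le> u \<omega>"
    \<comment> \<open>The slacks run through a sequence, so that countably many exceptional null
      sets can be merged before the limit is taken.\<close>
    have "AE \<omega> in M. ereal (?K - (1 + inverse (real (Suc k))) * opt_loss n (Y \<omega>)) \<le> u \<omega>" for k
    proof -
      obtain w where w: "w \<in> strategies F n T"
        and le: "AE \<omega> in M. ?L w \<omega> \<le> ennreal ((1 + inverse (real (Suc k))) * opt_loss n (Y \<omega>))"
        using near_optimal_strategy[OF n Y, of "inverse (real (Suc k))"] by auto
      have "AE \<omega> in M. ?U w \<omega> \<le> u \<omega>" using ub w by auto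
      with le U[OF w] show ?thesis
      proof eventually_elim
        case (elim \<omega>)
        have "ereal ?K - enn2ereal (ennreal ((1 + inverse (real (Suc k))) * opt_loss n (Y \<omega>))) \<le> ?U w \<omega>"
          unfolding elim(2) by (simp only: ereal_const_diff_le_iff elim(1))
        also have "\<dots> \<le> u \<omega>" by (rule elim(3))
        finally show ?case by (subst (asm) enn2ereal_ennreal) (auto simp: opt_loss_nonneg)
      qed
    qed
    then have "AE \<omega> in M. \<forall>k. ereal (?K - (1 + inverse (real (Suc k))) * opt_loss n (Y \<omega>)) \<le> u \<omega>"
      unfolding AE_all_countable by (rule allI)
    then show "AE \<omega> in M. ereal (?K - opt_loss n (Y \<omega>)) \<le> u \<omega>"
    proof eventually_elim
      case (elim \<omega>)
      have "(\<lambda>k. ereal (?K - (1 + inverse (real (Suc k))) * opt_loss n (Y \<omega>)))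
          \<longlonglongrightarrow> ereal (?K - opt_loss n (Y \<omega>))"
        by (intro tendsto_ereal tendsto_diff tendsto_const LIMSEQ_relative_slack)
      then show ?case by (rule Lim_bounded[where M = 0]) (use elim in blast)
    qed
  qed
qed

text \<open>The version chosen by the value function is replaced by the explicit one under the
  conditional expectation; this needs both its measurability and its almost sure equality.\<close>

lemma bellman_objective_AE:
  assumes n: "n < T" and Y: "Y \<in> borel_measurable (F n)" and v: "v \<in> borel_measurable (F n)"
  shows "AE \<omega> in M. bellman_objective M F r X \<alpha> T n Y v \<omega>
    = ereal (1 / (2 * \<alpha>))
      - enn2ereal (nn_cond_exp M (F n) (\<lambda>\<omega>. ennreal (opt_loss (Suc n) (Y \<omega> * R (Suc n) v \<omega>))) \<omega>)"
proof -
  let ?Y = "\<lambda>\<omega>. Y \<omega> * R (Suc n) v \<omega>"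
  let ?V = "value_function M F r X \<alpha> T (Suc n) ?Y"
  have Y': "?Y \<in> borel_measurable (F (Suc n))" by (rule measurable_next_wealth[OF n Y v])
  have [measurable]: "?Y \<in> borel_measurable M" by (rule measurable_F_M[OF Y'])
  have sn: "Suc n \<le> T" using n by simp
  note ess = ess_sup_eq_AE[OF is_ess_sup_utility[OF sn Y'], folded value_function_def]
  have "AE \<omega> in M. ereal_cond_exp M (F n) ?V \<omega>
      = ereal_cond_exp M (F n) (\<lambda>\<omega>. ereal (1 / (2 * \<alpha>) - opt_loss (Suc n) (?Y \<omega>))) \<omega>"
    by (rule ereal_cond_exp_cong[OF ess(1) measurable_F_M[OF ess(2)]]) simp
  moreover have "AE \<omega> in M. ereal_cond_exp M (F n) (\<lambda>\<omega>. ereal (1 / (2 * \<alpha>) - opt_loss (Suc n) (?Y \<omega>))) \<omega>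
      = ereal (1 / (2 * \<alpha>)) - enn2ereal (nn_cond_exp M (F n) (\<lambda>\<omega>. ennreal (opt_loss (Suc n) (?Y \<omega>))) \<omega>)"
    using alpha_pos by (intro ereal_cond_exp_const_diff) (auto simp: opt_loss_nonneg)
  ultimately show ?thesis unfolding bellman_objective_def by eventually_elim simp
qed

text \<open>\<open>opt_loss n\<close> is the greatest lower bound of the conditional losses,
  attained or not. Comparison with near-optimal weights pushes a maximizer down to it; conversely no
  competitor gets below it.\<close>

lemma bellman_maximizer_iff:
  assumes n: "n < T" and Y: "Y \<in> borel_measurable (F n)"
  shows "bellman_maximizer M F r X \<alpha> T n Y v \<longleftrightarrow> v \<in> borel_measurable (F n) \<and>
    (AE \<omega> in M. nn_cond_exp M (F n) (\<lambda>\<omega>. ennreal (opt_loss (Suc n) (Y \<omega> * R (Suc n) v \<omega>))) \<omega>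
      \<le> ennreal (opt_loss n (Y \<omega>)))"
proof (intro iffI conjI)
  let ?L = "\<lambda>v. nn_cond_exp M (F n) (\<lambda>\<omega>. ennreal (opt_loss (Suc n) (Y \<omega> * R (Suc n) v \<omega>)))"
  assume max: "bellman_maximizer M F r X \<alpha> T n Y v"
  then show v: "v \<in> borel_measurable (F n)" by (simp add: bellman_maximizer_def)
  have "AE \<omega> in M. ?L v \<omega> \<le> ennreal ((1 + inverse (real (Suc k))) * opt_loss n (Y \<omega>))" for k
  proof -
    obtain u where u: "u \<in> borel_measurable (F n)"
      and le: "AE \<omega> in M. ?L u \<omega> \<le> ennreal ((1 + inverse (real (Suc k))) * opt_loss n (Y \<omega>))"
      using near_optimal_weights[OF n Y, of "inverse (real (Suc k))"] by auto
    have "AE \<omega> in M. bellman_objective M F r X \<alpha> T n Y u \<omega> \<le> bellman_objective M F r X \<alpha> T n Y v \<omega>"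
      using max u by (simp add: bellman_maximizer_def)
    with le bellman_objective_AE[OF n Y u] bellman_objective_AE[OF n Y v] show ?thesis
      by eventually_elim (simp add: ereal_const_diff_le_iff)
  qed
  then have "AE \<omega> in M. \<forall>k. ?L v \<omega> \<le> ennreal ((1 + inverse (real (Suc k))) * opt_loss n (Y \<omega>))"
    unfolding AE_all_countable by (rule allI)
  then show "AE \<omega> in M. ?L v \<omega> \<le> ennreal (opt_loss n (Y \<omega>))"
  proof eventually_elim
    case (elim \<omega>)
    have "(\<lambda>k. ennreal ((1 + inverse (real (Suc k))) * opt_loss n (Y \<omega>))) \<longlonglongrightarrow> ennreal (opt_loss n (Y \<omega>))"
      by (intro tendsto_ennrealI LIMSEQ_relative_slack)
    then show ?case by (rule Lim_bounded2[where N = 0]) (use elim in blast)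
  qed
next
  let ?L = "\<lambda>v. nn_cond_exp M (F n) (\<lambda>\<omega>. ennreal (opt_loss (Suc n) (Y \<omega> * R (Suc n) v \<omega>)))"
  assume v: "v \<in> borel_measurable (F n) \<and> (AE \<omega> in M. ?L v \<omega> \<le> ennreal (opt_loss n (Y \<omega>)))"
  show "bellman_maximizer M F r X \<alpha> T n Y v"
    unfolding bellman_maximizer_def
  proof (intro conjI ballI)
    fix u :: "'a \<Rightarrow> real ^ 'k" assume u: "u \<in> borel_measurable (F n)"
    have "AE \<omega> in M. ?L v \<omega> \<le> ennreal (opt_loss n (Y \<omega>))" using v by simp
    with bellman_objective_AE[OF n Y u] bellman_objective_AE[OF n Y conjunct1[OF v]] opt_loss_le_cond_exp[OF n Y u]
    show "AE \<omega> in M. bellman_objective M F r X \<alpha> T n Y u \<omega> \<le> bellman_objective M F r X \<alpha> T n Y v \<omega>"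
      by eventually_elim (simp add: ereal_const_diff_le_iff order_trans)
  qed (use v in simp)
qed

text \<open>At nonzero wealth the two losses at time \<open>n\<close> agree, while
  \<open>quad_loss\<close> is below \<open>opt_loss\<close> at the next date. A maximizer thus
  reaches the minimum of the expected quadratic loss, whose minimiser is unique.\<close>

lemma bellman_maximizer_unique:
  assumes n: "n < T" and Y: "Y \<in> borel_measurable (F n)" and Y0: "AE \<omega> in M. Y \<omega> \<noteq> 0"
    and max: "bellman_maximizer M F r X \<alpha> T n Y v"
  shows "AE \<omega> in M. v \<omega> = scaled_weights 1 n (Y \<omega>)"
proof -
  have v: "v \<in> borel_measurable (F n)" and le: "AE \<omega> in M.
      nn_cond_exp M (F n) (\<lambda>\<omega>. ennreal (opt_loss (Suc n) (Y \<omega> * R (Suc n) v \<omega>))) \<omega>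
        \<le> ennreal (opt_loss n (Y \<omega>))"
    using max unfolding bellman_maximizer_iff[OF n Y] by auto
  have "AE \<omega> in M. nn_cond_exp M (F n) (\<lambda>\<omega>. ennreal (opt_loss (Suc n) (Y \<omega> * R (Suc n) v \<omega>))) \<omega>
      = (\<integral>\<^sup>+x. ennreal (opt_loss (Suc n) (Y \<omega> * R (Suc n) (\<lambda>_. v \<omega>) x)) \<partial>M)"
    using cond_exp_next_wealth[OF n Y v, of "\<lambda>_ z. ennreal (opt_loss (Suc n) z)"] by simp
  with le Y0 show ?thesis
  proof eventually_elim
    case (elim \<omega>)
    have "(\<integral>\<^sup>+x. ennreal (quad_loss (Suc n) (Y \<omega> * R (Suc n) (\<lambda>_. v \<omega>) x)) \<partial>M)
        \<le> (\<integral>\<^sup>+x. ennreal (opt_loss (Suc n) (Y \<omega> * R (Suc n) (\<lambda>_. v \<omega>) x)) \<partial>M)"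
      using n by (intro nn_integral_mono ennreal_leI quad_le_opt_loss) simp
    also have "\<dots> \<le> ennreal (quad_loss n (Y \<omega>))"
      using elim by (simp add: opt_loss_def)
    finally show ?case by (intro expected_quad_loss_minimizer[OF n elim(2)])
  qed
qed

text \<open>If the next wealth avoids zero, \<open>opt_loss\<close> and \<open>quad_loss\<close>
  coincide along it and the quadratic minimum is attained. At the terminal date they coincide
  everywhere, so \<open>next0\<close> is asked only for earlier periods.\<close>

lemma scaled_weights_maximizer:
  assumes n: "n < T" and Y: "Y \<in> borel_measurable (F n)" and Y0: "AE \<omega> in M. Y \<omega> \<noteq> 0"
    and v: "v \<in> borel_measurable (F n)" and opt: "AE \<omega> in M. v \<omega> = scaled_weights 1 n (Y \<omega>)"
    and next0: "Suc n < T \<Longrightarrow> AE \<omega> in M. Y \<omega> * R (Suc n) v \<omega> \<noteq> 0"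
  shows "bellman_maximizer M F r X \<alpha> T n Y v"
proof -
  have [measurable]: "(\<lambda>\<omega>. Y \<omega> * R (Suc n) v \<omega>) \<in> borel_measurable M"
    by (rule measurable_F_M[OF measurable_next_wealth[OF n Y v]])
  have "AE \<omega> in M. opt_loss (Suc n) (Y \<omega> * R (Suc n) v \<omega>) = quad_loss (Suc n) (Y \<omega> * R (Suc n) v \<omega>)"
  proof (cases "Suc n < T")
    case True
    from next0[OF True] show ?thesis by eventually_elim (simp add: opt_loss_def)
  next
    case False
    then have "Suc n = T" using n by simp
    then show ?thesis by (simp add: opt_loss_T)
  qed
  then have "AE \<omega> in M. ennreal (opt_loss (Suc n) (Y \<omega> * R (Suc n) v \<omega>)) = ennreal (quad_loss (Suc n) (Y \<omega> * R (Suc n) v \<omega>))"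
    by eventually_elim simp
  then have "AE \<omega> in M. nn_cond_exp M (F n) (\<lambda>\<omega>. ennreal (opt_loss (Suc n) (Y \<omega> * R (Suc n) v \<omega>))) \<omega>
      = nn_cond_exp M (F n) (\<lambda>\<omega>. ennreal (quad_loss (Suc n) (Y \<omega> * R (Suc n) v \<omega>))) \<omega>"
    by (rule nn_cond_exp_cong) auto
  moreover have "AE \<omega> in M. nn_cond_exp M (F n) (\<lambda>\<omega>. ennreal (quad_loss (Suc n) (Y \<omega> * R (Suc n) v \<omega>))) \<omega>
      = (\<integral>\<^sup>+x. ennreal (quad_loss (Suc n) (Y \<omega> * R (Suc n) (\<lambda>_. v \<omega>) x)) \<partial>M)"
    using cond_exp_next_wealth[OF n Y v, of "\<lambda>_ z. ennreal (quad_loss (Suc n) z)"] by simp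
  ultimately have "AE \<omega> in M. nn_cond_exp M (F n) (\<lambda>\<omega>. ennreal (opt_loss (Suc n) (Y \<omega> * R (Suc n) v \<omega>))) \<omega>
      \<le> ennreal (opt_loss n (Y \<omega>))"
    using Y0 opt
  proof eventually_elim
    case (elim \<omega>)
    then show ?case
      by (simp add: expected_scaled_weights[OF n elim(3)] opt_loss_def)
  qed
  with v show ?thesis unfolding bellman_maximizer_iff[OF n Y] by simp
qed

end

text \<open>The first implication says that every maximizer has the closed form, the second that the
  closed form is a maximizer. The second asks for nonzero next wealth if \<open>t > 1\<close>,
  because the value function may jump down at zero wealth; for \<open>t = 1\<close> the next value
  is the utility itself, which is continuous.\<close>

theorem corollary2:
  fixes M :: "'a measure"
    and F :: "nat \<Rightarrow> 'a measure"
    and X :: "nat \<Rightarrow> 'a \<Rightarrow> real ^ 'k"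
    and r :: "nat \<Rightarrow> real"
    and \<mu> :: "nat \<Rightarrow> real ^ 'k"
    and \<Sigma> :: "nat \<Rightarrow> real ^ 'k ^ 'k"
    and \<alpha> W\<^sub>0 :: real
    and T :: nat
    and w :: "nat \<Rightarrow> 'a \<Rightarrow> real ^ 'k"
    and W :: "nat \<Rightarrow> 'a \<Rightarrow> real"
  assumes "prob_space M"
    and "filtration (space M) F"
    and "\<And>\<tau>. subalgebra M (F \<tau>)"
    and "\<And>\<tau>. \<tau> \<le> T \<Longrightarrow> X \<tau> \<in> borel_measurable (F \<tau>)"
    and "\<And>\<tau>. \<tau> \<in> {1..T} \<Longrightarrow>
           prob_space.indep_set M (sets (F (\<tau> - 1))) (sets (vimage_algebra (space M) (X \<tau>) borel))"
    and "\<And>\<tau> i. \<tau> \<le> T \<Longrightarrow> integrable M (\<lambda>\<omega>. (X \<tau> \<omega> $ i)\<^sup>2)"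
    and "\<And>\<tau>. \<tau> \<le> T \<Longrightarrow> (\<integral>\<omega>. X \<tau> \<omega> \<partial>M) = \<mu> \<tau>"
    and "\<And>\<tau>. \<tau> \<le> T \<Longrightarrow> covariance_matrix M (X \<tau>) = \<Sigma> \<tau>"
    and "\<And>\<tau>. \<tau> \<le> T \<Longrightarrow> positive_definite (\<Sigma> \<tau>)"
    and "\<And>\<tau>. \<tau> \<in> {1..T} \<Longrightarrow> 1 + r \<tau> \<noteq> 0"
    and "\<alpha> > 0"
    and "w \<in> strategies F 0 T"
    and "W = wealth r X 0 (\<lambda>_. W\<^sub>0) w"
  shows "\<forall>t\<in>{1..T}. (AE \<omega> in M. W (T - t) \<omega> \<noteq> 0) \<longrightarrow>
           (bellman_maximizer M F r X \<alpha> T (T - t) (W (T - t)) (w (T - t)) \<longrightarrow>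
              (AE \<omega> in M. w (T - t) \<omega> =
                 alpha_inv \<alpha> r \<mu> \<Sigma> T (T - t + 1) (W (T - t) \<omega>) *\<^sub>R
                   (matrix_inv (\<Sigma> (T - t + 1)) *v excess_mean r \<mu> (T - t + 1)))) \<and>
           ((AE \<omega> in M. w (T - t) \<omega> =
                 alpha_inv \<alpha> r \<mu> \<Sigma> T (T - t + 1) (W (T - t) \<omega>) *\<^sub>R
                   (matrix_inv (\<Sigma> (T - t + 1)) *v excess_mean r \<mu> (T - t + 1))) \<and>
            (t > 1 \<longrightarrow> (AE \<omega> in M. W (T - t + 1) \<omega> \<noteq> 0)) \<longrightarrow>
              bellman_maximizer M F r X \<alpha> T (T - t) (W (T - t)) (w (T - t)))"
proof (intro ballI impI)
  interpret prob_space M by fact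
  interpret portfolio M F X r \<mu> \<Sigma> \<alpha> T
    by (intro portfolio.intro portfolio_axioms.intro assms)
  fix t assume t: "t \<in> {1..T}" and W0: "AE \<omega> in M. W (T - t) \<omega> \<noteq> 0"
  define n where "n = T - t"
  have n: "n < T" using t by (auto simp: n_def)
  have W: "W n \<in> borel_measurable (F n)"
    using measurable_wealth[OF assms(12), of "\<lambda>_. W\<^sub>0" n] n assms(13) by simp
  have w: "w n \<in> borel_measurable (F n)" using assms(12) n by (simp add: strategies_def)
  have next_W: "W (Suc n) = (\<lambda>\<omega>. W n \<omega> * R (Suc n) (w n) \<omega>)" by (simp add: assms(13))
  have weights: "scaled_weights 1 n y = alpha_inv \<alpha> r \<mu> \<Sigma> T (n + 1) y *\<^sub>R
      (matrix_inv (\<Sigma> (n + 1)) *v excess_mean r \<mu> (n + 1))" for y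
    by (simp add: scaled_weights_def hedge_def)
  note W0 = W0[folded n_def]
  have "Suc n < T \<longleftrightarrow> t > 1" using t by (auto simp: n_def)
  then show "(bellman_maximizer M F r X \<alpha> T (T - t) (W (T - t)) (w (T - t)) \<longrightarrow>
              (AE \<omega> in M. w (T - t) \<omega> =
                 alpha_inv \<alpha> r \<mu> \<Sigma> T (T - t + 1) (W (T - t) \<omega>) *\<^sub>R
                   (matrix_inv (\<Sigma> (T - t + 1)) *v excess_mean r \<mu> (T - t + 1)))) \<and>
           ((AE \<omega> in M. w (T - t) \<omega> =
                 alpha_inv \<alpha> r \<mu> \<Sigma> T (T - t + 1) (W (T - t) \<omega>) *\<^sub>R
                   (matrix_inv (\<Sigma> (T - t + 1)) *v excess_mean r \<mu> (T - t + 1))) \<and>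
            (t > 1 \<longrightarrow> (AE \<omega> in M. W (T - t + 1) \<omega> \<noteq> 0)) \<longrightarrow>
              bellman_maximizer M F r X \<alpha> T (T - t) (W (T - t)) (w (T - t)))"
    using bellman_maximizer_unique[OF n W W0] scaled_weights_maximizer[OF n W W0 w]
    unfolding n_def[symmetric] weights[symmetric] by (auto simp only: Suc_eq_plus1 next_W[unfolded Suc_eq_plus1])
qed

end
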